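(* Let $\mathfrak p\ge 2$ and $\nu\ge1$ be integers, let $\omega\in\mathbb R^\nu$ be rationally independent (i.e. $n\cdot\omega=0$ with $n\in\mathbb Z^\nu$ implies $n=0$), and let $c:\mathbb Z^\nu\to\mathbb C$ satisfy $$|c(n)|\le \mathcal A^{\frac{1}{\mathfrak p-1}}e^{-\kappa|n|}\quad\text{for all }n\in\mathbb Z^\nu,$$ for some constants $\mathcal A>0$ and $0<\kappa\le1$. Put $u_0(x)=\sum_{n\in\mathbb Z^\nu}c(n)e^{{\rm i}(n\cdot\omega)x}$, $\Box=2(6\kappa^{-1})^{\nu}\mathcal A^{\frac{1}{\mathfrak p-1}}$ and $$t_0=\min\left\{\frac{\kappa^{(\mathfrak p-1)\nu+1}}{2^{\mathfrak p+1}6^{(\mathfrak p-1)\nu+1}\mathcal A|\omega|},\ \frac{\kappa^{(\mathfrak p-1)\nu+1}}{2(\mathfrak p-1)e\,\Box^{\mathfrak p-1}12^{(\mathfrak p-1)\nu+1}|\omega|}\right\}>0 .$$ Then there exist coefficients $c^\dagger:[0,t_0)\times\mathbb Z^\nu\to\mathbb C$ with $$|c^\dagger(t,n)|\le \Box e^{-\frac{\kappa}{2}|n|}\quad\text{for all }0\le t<t_0,\ n\in\mathbb Z^\nu,$$ satisfying, for all $0\le t<t_0$ and $n\in\mathbb Z^\nu$, $$c^\dagger(t,n)=e^{{\rm i}(n\cdot\omega)^3t}c(n)-\frac{{\rm i}\,n\cdot\omega}{\mathfrak p}\int_0^t e^{{\rm i}(n\cdot\omega)^3(t-\tau)}\sum_{\substack{n_1,\dots,n_{\mathfrak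 p}\in\mathbb Z^\nu\\ n_1+\dots+n_{\mathfrak p}=n}}\prod_{j=1}^{\mathfrak p}c^\dagger(\tau,n_j)\,{\rm d}\tau,$$ and such that the spatially $\omega$-quasi-periodic function $u^\dagger(t,x)=\sum_{n\in\mathbb Z^\nu}c^\dagger(t,n)e^{{\rm i}(n\cdot\omega)x}$ ($0\le t<t_0$, $x\in\mathbb R$) is a classical solution of the generalized KdV equation $$\partial_tu+\partial_x^3u+u^{\mathfrak p-1}\partial_xu=0$$ on $[0,t_0)\times\mathbb R$ with $u^\dagger(0,x)=u_0(x)$. Moreover $c^\dagger(t,n)=\lim_{k\to\infty}c_k(t,n)$, where $c_k$ are the Picard iterates defined in the context.
   Context: Notation: for $n=(n^1,\dots,n^\nu)\in\mathbb Z^\nu$, $|n|=\sum_{i=1}^\nu|n^i|$ (the $\ell^1$ norm); $|\omega|$ is the Euclidean norm of $\omega\in\mathbb R^\nu$. Picard iterates: $c_0(t,n)=e^{{\rm i}(n\cdot\omega)^3t}c(n)$ and, for $k\ge1$, $$c_k(t,n)=c_0(t,n)-\frac{{\rm i}\,n\cdot\omega}{\mathfrak p}\int_0^t e^{{\rm i}(n\cdot\omega)^3(t-\tau)}\sum_{\substack{n_1,\dots,n_{\mathfrak p}\in\mathbb Z^\nu\\ n_1+\dots+n_{\mathfrak p}=n}}\prod_{j=1}^{\mathfrak p}c_{k-1}(\tau,n_j)\,{\rm d}\tau .$$ *)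

theory Defs
  imports "HOL-Analysis.Analysis"
begin

definition dotw :: "int^'n \<Rightarrow> real^'n \<Rightarrow> real" where
  "dotw n \<omega> = (\<Sum>i\<in>UNIV. of_int (n$i) * \<omega>$i)"

definition l1norm :: "int^'n \<Rightarrow> real" where
  "l1norm n = (\<Sum>i\<in>UNIV. of_int \<bar>n$i\<bar>)"

definition tuples :: "nat \<Rightarrow> int^'n \<Rightarrow> (nat \<Rightarrow> int^'n) set" where
  "tuples p n = {f. f \<in> {..<p} \<rightarrow>\<^sub>E UNIV \<and> (\<Sum>j<p. f j) = n}"

definition conv_summand :: "nat \<Rightarrow> (int^'n \<Rightarrow> complex) \<Rightarrow> (nat \<Rightarrow> int^'n) \<Rightarrow> complex" where
  "conv_summand p a f = (\<Prod>j<p. a (f j))"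

definition conv :: "nat \<Rightarrow> (int^'n \<Rightarrow> complex) \<Rightarrow> int^'n \<Rightarrow> complex" where
  "conv p a n = (\<Sum>\<^sub>\<infinity>f\<in>tuples p n. conv_summand p a f)"

definition duhamel_integrand ::
  "nat \<Rightarrow> real^'n \<Rightarrow> (real \<Rightarrow> int^'n \<Rightarrow> complex) \<Rightarrow> real \<Rightarrow> int^'n \<Rightarrow> real \<Rightarrow> complex" where
  "duhamel_integrand p \<omega> a t n \<tau> =
     exp (\<i> * of_real ((dotw n \<omega>)^3 * (t - \<tau>))) * conv p (a \<tau>) n"

definition duhamel ::
  "nat \<Rightarrow> real^'n \<Rightarrow> (int^'n \<Rightarrow> complex) \<Rightarrow> (real \<Rightarrow> int^'n \<Rightarrow> complex) \<Rightarrow> real \<Rightarrow> int^'n \<Rightarrow> complex" where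
  "duhamel p \<omega> c a t n =
     exp (\<i> * of_real ((dotw n \<omega>)^3 * t)) * c n
     - (\<i> * of_real (dotw n \<omega>) / of_nat p) * integral {0..t} (duhamel_integrand p \<omega> a t n)"

fun picard :: "nat \<Rightarrow> real^'n \<Rightarrow> (int^'n \<Rightarrow> complex) \<Rightarrow> nat \<Rightarrow> real \<Rightarrow> int^'n \<Rightarrow> complex" where
  "picard p \<omega> c 0 t n = exp (\<i> * of_real ((dotw n \<omega>)^3 * t)) * c n"
| "picard p \<omega> c (Suc k) t n = duhamel p \<omega> c (picard p \<omega> c k) t n"

definition gkdv_classical_solution :: "nat \<Rightarrow> real \<Rightarrow> (real \<Rightarrow> real \<Rightarrow> complex) \<Rightarrow> bool" where
  "gkdv_classical_solution p T u \<longleftrightarrow>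
     (\<exists>ut ux uxx uxxx :: real \<Rightarrow> real \<Rightarrow> complex.
        (\<forall>t\<in>{0..<T}. \<forall>x.
            ((\<lambda>s. u s x) has_vector_derivative ut t x) (at t within {0..<T})
          \<and> ((\<lambda>y. u t y) has_vector_derivative ux t x) (at x)
          \<and> ((\<lambda>y. ux t y) has_vector_derivative uxx t x) (at x)
          \<and> ((\<lambda>y. uxx t y) has_vector_derivative uxxx t x) (at x)
          \<and> ut t x + uxxx t x + (u t x) ^ (p - 1) * ux t x = 0)
      \<and> continuous_on ({0..<T} \<times> UNIV) (\<lambda>(t, x). u t x)
      \<and> continuous_on ({0..<T} \<times> UNIV) (\<lambda>(t, x). ut t x)
      \<and> continuous_on ({0..<T} \<times> UNIV) (\<lambda>(t, x). ux t x)
      \<and> continuous_on ({0..<T} \<times> UNIV) (\<lambda>(t, x). uxx t x)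
      \<and> continuous_on ({0..<T} \<times> UNIV) (\<lambda>(t, x). uxxx t x))"

end

theory Submission
  imports Defs
begin

text \<open>Weighting the \<open>n\<close>-th coefficient at time \<open>t\<close> by \<open>exp ((\<sigma> - L t) |n|)\<close> makes the Duhamel
  integral gain a factor \<open>1 / (L |n|)\<close>, which compensates the derivative in the nonlinearity.
  The weighted Picard iterates are then dominated by the time-independent majorants
  \<open>m\<^sub>k\<^sub>+\<^sub>1 = m\<^sub>0 + |\<omega>| / (p L) m\<^sub>k * \<dots> * m\<^sub>k\<close> (a \<open>p\<close>-fold convolution), whose \<open>\<ell>\<^sup>1\<close> norms stay below
  \<open>Box\<close> for \<open>L = 2 |\<omega>| Box ^ (p - 1)\<close> and \<open>\<sigma> = \<kappa> / 2 + L t0\<close>. The second term in the minimum defining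
  \<open>t0\<close> makes \<open>L t0\<close> so small that \<open>m\<^sub>0\<close> has \<open>\<ell>\<^sup>1\<close> norm at most \<open>3/4 Box\<close>. Exponential decay of the limit
  coefficients permits termwise differentiation of the Fourier series, and the nonlinearity is
  recovered by differentiating \<open>u ^ p\<close>, the series with the convolved coefficients.\<close>

subsection \<open>Convolution powers\<close>

text \<open>Generic in the value field, so that one set of facts serves both the complex
  coefficients and their real majorants.\<close>

definition conv_power :: "nat \<Rightarrow> (int^'n \<Rightarrow> 'a) \<Rightarrow> int^'n \<Rightarrow> 'a::{real_normed_field, banach}" where
  "conv_power p b n = (\<Sum>\<^sub>\<infinity>f\<in>tuples p n. \<Prod>j<p. b (f j))"

lemma conv_eq_conv_power: "conv p = conv_power p"
  by (simp add: fun_eq_iff conv_def conv_power_def conv_summand_def)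

lemma has_sum_diff:
  fixes f g :: "'b \<Rightarrow> 'a::real_normed_vector"
  assumes "(f has_sum a) A" "(g has_sum b) A"
  shows "((\<lambda>x. f x - g x) has_sum (a - b)) A"
  using has_sum_add[OF assms(1), of "\<lambda>x. - g x" "- b"] assms(2) by (simp add: has_sum_uminus)

text \<open>Every \<open>p\<close>-tuple has exactly one sum, so the sets \<open>tuples p n\<close>
  partition all \<open>p\<close>-tuples. This is the reindexing that turns a double sum over
  \<open>n\<close> and \<open>tuples p n\<close> into a sum over a product set.\<close>

lemma bij_betw_tuples: "bij_betw snd (Sigma UNIV (tuples p)) ({..<p} \<rightarrow>\<^sub>E UNIV)"
proof (rule bij_betw_imageI)
  show "inj_on snd (Sigma UNIV (tuples p))"
    unfolding inj_on_def tuples_def by clarsimp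
  show "snd ` Sigma UNIV (tuples p) = {..<p} \<rightarrow>\<^sub>E UNIV"
    unfolding tuples_def by (force simp del: PiE_UNIV_domain)
qed

text \<open>A finite set of choice functions lies in a finite box \<open>PiE A V\<close>, over which
  the sum of products factorises. The product of the total masses therefore bounds every finite
  partial sum.\<close>

lemma norm_prod_summable_PiE:
  fixes f :: "'i \<Rightarrow> 'b \<Rightarrow> 'a::real_normed_field"
  assumes "finite A" and f: "\<And>i. i \<in> A \<Longrightarrow> (\<lambda>n. norm (f i n)) summable_on B i"
  shows "(\<lambda>g. norm (\<Prod>i\<in>A. f i (g i))) summable_on PiE A B"
proof (rule nonneg_bdd_above_summable_on)
  have "(\<Sum>g\<in>F. norm (\<Prod>i\<in>A. f i (g i))) \<le> (\<Prod>i\<in>A. \<Sum>\<^sub>\<infinity>n\<in>B i. norm (f i n))"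
    if F: "F \<subseteq> PiE A B" "finite F" for F
  proof -
    define V where "V i = (\<lambda>g. g i) ` F" for i
    have V: "finite (V i)" "i \<in> A \<Longrightarrow> V i \<subseteq> B i" for i using F by (auto simp: V_def)
    have "(\<Sum>g\<in>F. norm (\<Prod>i\<in>A. f i (g i))) \<le> (\<Sum>g\<in>PiE A V. norm (\<Prod>i\<in>A. f i (g i)))"
      by (rule sum_mono2) (use F V(1) \<open>finite A\<close> in \<open>auto simp: V_def finite_PiE PiE_iff\<close>)
    also have "\<dots> = (\<Prod>i\<in>A. \<Sum>n\<in>V i. norm (f i n))"
      unfolding prod_norm[symmetric] using V \<open>finite A\<close>
      by (intro prod_sum_PiE[of A V "\<lambda>i n. norm (f i n)", symmetric])
    also have "\<dots> \<le> (\<Prod>i\<in>A. \<Sum>\<^sub>\<infinity>n\<in>B i. norm (f i n))"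
      by (intro prod_mono conjI finite_sum_le_infsum f V sum_nonneg) auto
    finally show ?thesis .
  qed
  then show "bdd_above (sum (\<lambda>g. norm (\<Prod>i\<in>A. f i (g i))) ` {F. F \<subseteq> PiE A B \<and> finite F})"
    by (auto intro!: bdd_aboveI)
qed auto

text \<open>One Fubini argument gives all three facts: the products are absolutely summable over all
  \<open>p\<close>-tuples, and these are fibred by their sum. The middle fact says that the total
  sum is multiplicative under convolution, which reduces mass bounds to a scalar inequality.\<close>

lemma
  fixes b :: "int^'n \<Rightarrow> 'a::{real_normed_field, banach}"
  assumes b: "(\<lambda>n. norm (b n)) summable_on UNIV"
  shows tuples_summable: "(\<lambda>f. \<Prod>j<p. b (f j)) summable_on tuples p n"
    and infsum_conv_power: "(\<Sum>\<^sub>\<infinity>n. conv_power p b n) = (\<Sum>\<^sub>\<infinity>n. b n) ^ p"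
    and summable_conv_power: "conv_power p b summable_on UNIV"
proof -
  have "(\<lambda>x. norm (\<Prod>j<p. b (snd x j))) summable_on Sigma UNIV (tuples p)"
    using norm_prod_summable_PiE[of "{..<p}" "\<lambda>_. b" "\<lambda>_. UNIV"] b
      summable_on_reindex_bij_betw[OF bij_betw_tuples, of "\<lambda>f. norm (\<Prod>j<p. b (f j))" p] by simp
  then have 1: "(\<lambda>(n, f). norm (\<Prod>j<p. b (f j))) summable_on Sigma UNIV (tuples p)"
    by (simp add: case_prod_unfold)
  then have "(\<lambda>f. norm (\<Prod>j<p. b (f j))) summable_on tuples p n"
    by (rule summable_on_SigmaD1) auto
  then show "(\<lambda>f. \<Prod>j<p. b (f j)) summable_on tuples p n"
    by (rule abs_summable_summable)
  have 3: "(\<lambda>(n, f). \<Prod>j<p. b (f j)) summable_on Sigma UNIV (tuples p)"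
    by (rule abs_summable_summable) (use 1 in \<open>simp add: case_prod_unfold\<close>)
  show "conv_power p b summable_on UNIV"
    unfolding conv_power_def[abs_def] using summable_on_Sigma_banach[OF 3] by simp
  have "(\<Sum>\<^sub>\<infinity>n. conv_power p b n) = (\<Sum>\<^sub>\<infinity>(n, f)\<in>Sigma UNIV (tuples p). \<Prod>j<p. b (f j))"
    unfolding conv_power_def[abs_def] by (rule infsum_Sigma'_banach[OF 3])
  also have "\<dots> = (\<Sum>\<^sub>\<infinity>f\<in>{..<p} \<rightarrow>\<^sub>E UNIV. \<Prod>j<p. b (f j))"
    using infsum_reindex_bij_betw[OF bij_betw_tuples, of "\<lambda>f. (\<Prod>j<p. b (f j))" p]
    by (simp add: case_prod_unfold)
  also have "\<dots> = (\<Sum>\<^sub>\<infinity>n. b n) ^ p"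
    using infsum_prod_PiE_abs[of "{..<p}" "\<lambda>_. b" "\<lambda>_. UNIV"] b by simp
  finally show "(\<Sum>\<^sub>\<infinity>n. conv_power p b n) = (\<Sum>\<^sub>\<infinity>n. b n) ^ p" .
qed

section \<open>Positivity and monotonicity of real convolution powers\<close>

lemma conv_power_nonneg: "(\<And>n. (0::real) \<le> m n) \<Longrightarrow> 0 \<le> conv_power p m n"
  unfolding conv_power_def by (intro infsum_nonneg prod_nonneg) auto

lemma conv_power_mono:
  fixes m m' :: "int^'n \<Rightarrow> real"
  assumes "\<And>n. 0 \<le> m n" "\<And>n. m n \<le> m' n" "m' summable_on UNIV"
  shows "conv_power p m n \<le> conv_power p m' n"
proof -
  have 1: "0 \<le> m' n" for n using assms(1,2) order_trans by blast
  have "m summable_on UNIV"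
    by (rule summable_on_comparison_test[OF assms(3)]) (use assms in auto)
  then show ?thesis
    unfolding conv_power_def using assms 1
    by (intro infsum_mono prod_mono tuples_summable) auto
qed

subsection \<open>Frequencies and exponential weights\<close>

lemma l1norm_nonneg: "0 \<le> l1norm n"
  unfolding l1norm_def by (intro sum_nonneg) auto

lemma l1norm_triangle: "l1norm (a + b) \<le> l1norm a + l1norm b"
  unfolding l1norm_def sum.distrib[symmetric] by (intro sum_mono) auto

lemma l1norm_sum: "finite J \<Longrightarrow> l1norm (\<Sum>j\<in>J. f j) \<le> (\<Sum>j\<in>J. l1norm (f j))"
proof (induction J rule: finite_induct)
  case empty
  then show ?case by (simp add: l1norm_def)
next
  case (insert x F)
  then show ?case using l1norm_triangle[of "f x" "sum f F"] by simp
qed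

lemma abs_dotw_le: "\<bar>dotw n \<omega>\<bar> \<le> norm \<omega> * l1norm n"
proof -
  have "\<bar>dotw n \<omega>\<bar> \<le> (\<Sum>i\<in>UNIV. \<bar>of_int (n$i) * \<omega>$i\<bar>)"
    unfolding dotw_def by (rule sum_abs)
  also have "\<dots> \<le> (\<Sum>i\<in>UNIV. norm \<omega> * of_int \<bar>n$i\<bar>)"
    by (intro sum_mono) (simp add: abs_mult mult.commute mult_right_mono component_le_norm_cart)
  finally show ?thesis by (simp add: l1norm_def sum_distrib_left)
qed

lemma dotw_add: "dotw (a + b) \<omega> = dotw a \<omega> + dotw b \<omega>"
  by (simp add: dotw_def sum.distrib algebra_simps)

lemma dotw_sum: "finite J \<Longrightarrow> dotw (\<Sum>j\<in>J. f j) \<omega> = (\<Sum>j\<in>J. dotw (f j) \<omega>)"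
  by (induction J rule: finite_induct) (auto simp: dotw_add, simp add: dotw_def)

text \<open>The triangle inequality makes the weight submultiplicative along a tuple, so convolution
  costs nothing in the decay rate.\<close>

lemma prod_exp_l1norm_le:
  assumes "f \<in> tuples p n" "0 \<le> s"
  shows "(\<Prod>j<p. exp (- s * l1norm (f j))) \<le> exp (- s * l1norm n)"
proof -
  have "l1norm n \<le> (\<Sum>j<p. l1norm (f j))"
    using l1norm_sum[of "{..<p}" f] assms(1) by (auto simp: tuples_def)
  then have "s * l1norm n \<le> s * (\<Sum>j<p. l1norm (f j))"
    using assms(2) by (rule mult_left_mono)
  then show ?thesis
    by (simp add: exp_sum[symmetric] sum_negf sum_distrib_left)
qed

text \<open>Telescoping: with one factor split off, the difference of products is
  \<open>(a x - b x) * prod a F + b x * (prod a F - prod b F)\<close>, and the majorants obey the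
  same identity. The bound on \<open>prod a J\<close> is carried along because this step uses
  it.\<close>

lemma norm_prod_diff_majorant:
  fixes a b :: "'i \<Rightarrow> complex" and m m' v :: "'i \<Rightarrow> real"
  assumes "finite J"
    and "\<And>j. j \<in> J \<Longrightarrow> norm (a j - b j) \<le> v j * (m' j - m j)"
    and "\<And>j. j \<in> J \<Longrightarrow> norm (b j) \<le> v j * m j"
  shows "norm (prod a J - prod b J) \<le> prod v J * (prod m' J - prod m J)
       \<and> norm (prod b J) \<le> prod v J * prod m J \<and> norm (prod a J) \<le> prod v J * prod m' J"
  using assms
proof (induction J rule: finite_induct)
  case empty
  then show ?case by simp
next
  case (insert x F)
  note IH = insert.IH[OF insert.prems]
  have ab: "norm (a x - b x) \<le> v x * (m' x - m x)" "norm (b x) \<le> v x * m x"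
    using insert.prems by auto
  have a: "norm (a x) \<le> v x * m' x"
    using ab norm_triangle_sub[of "a x" "b x"] by (simp add: algebra_simps)
  have nn: "0 \<le> v x * m x" "0 \<le> v x * m' x" "0 \<le> v x * (m' x - m x)"
    using ab a norm_ge_zero order_trans by blast+
  have IH1: "norm (prod a F - prod b F) \<le> prod v F * (prod m' F - prod m F)"
    and IH2: "norm (prod b F) \<le> prod v F * prod m F"
    and IH3: "norm (prod a F) \<le> prod v F * prod m' F" using IH by auto
  have "a x * prod a F - b x * prod b F = (a x - b x) * prod a F + b x * (prod a F - prod b F)"
    by (simp add: algebra_simps)
  then have "norm (a x * prod a F - b x * prod b F)
      \<le> norm (a x - b x) * norm (prod a F) + norm (b x) * norm (prod a F - prod b F)"
    by (metis norm_mult norm_triangle_ineq)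
  also have "\<dots> \<le> (v x * (m' x - m x)) * (prod v F * prod m' F)
      + (v x * m x) * (prod v F * (prod m' F - prod m F))"
    by (intro add_mono mult_mono ab IH1 IH3 nn) auto
  finally have 1: "norm (a x * prod a F - b x * prod b F)
      \<le> v x * prod v F * (m' x * prod m' F - m x * prod m F)" by (simp add: algebra_simps)
  have "norm (b x * prod b F) \<le> (v x * m x) * (prod v F * prod m F)"
    "norm (a x * prod a F) \<le> (v x * m' x) * (prod v F * prod m' F)"
    unfolding norm_mult by (intro mult_mono ab a IH2 IH3 nn; simp)+
  with 1 show ?case using insert.hyps by (simp add: mult_ac)
qed

text \<open>The nonlinearity preserves the relation that increments of coefficients are dominated by
  weighted increments of majorants. The claim holds tuple by tuple, the weights combining by
  \<open>prod_exp_l1norm_le\<close>, and is then summed.\<close>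

lemma conv_power_majorant:
  fixes a b :: "int^'n \<Rightarrow> complex" and m m' :: "int^'n \<Rightarrow> real"
  assumes s: "0 \<le> s" and m: "\<And>n. 0 \<le> m n" "\<And>n. m n \<le> m' n" "m' summable_on UNIV"
    and ab: "\<And>n. norm (a n - b n) \<le> exp (- s * l1norm n) * (m' n - m n)"
    and b: "\<And>n. norm (b n) \<le> exp (- s * l1norm n) * m n"
  shows "norm (conv_power p a n - conv_power p b n) \<le> exp (- s * l1norm n) * (conv_power p m' n - conv_power p m n)"
proof -
  have m'0: "0 \<le> m' n" for n using m order_trans by blast
  have a: "norm (a n) \<le> exp (- s * l1norm n) * m' n" for n
    using ab[of n] b[of n] norm_triangle_sub[of "a n" "b n"] by (simp add: algebra_simps)
  have e1: "exp (- s * l1norm n) \<le> 1" for n :: "int^'n"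
    using s l1norm_nonneg[of n] by simp
  have ms: "m summable_on UNIV"
    by (rule summable_on_comparison_test[OF m(3)]) (use m in auto)
  have "norm (a n) \<le> m' n" "norm (b n) \<le> m n" for n
    using a[of n] b[of n] e1[of n] m m'0 by (meson mult_left_le_one_le exp_ge_zero order_trans)+
  then have as: "(\<lambda>n. norm (a n)) summable_on UNIV" and bs: "(\<lambda>n. norm (b n)) summable_on UNIV"
    by (auto intro: summable_on_comparison_test[OF m(3)] summable_on_comparison_test[OF ms])
  have m's: "(\<lambda>n. norm (m' n)) summable_on UNIV" "(\<lambda>n. norm (m n)) summable_on UNIV"
    using m m'0 ms by auto
  have le: "norm ((\<Prod>j<p. a (f j)) - (\<Prod>j<p. b (f j)))
      \<le> exp (- s * l1norm n) * ((\<Prod>j<p. m' (f j)) - (\<Prod>j<p. m (f j)))" if "f \<in> tuples p n" for f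
  proof -
    have "norm ((\<Prod>j<p. a (f j)) - (\<Prod>j<p. b (f j)))
      \<le> (\<Prod>j<p. exp (- s * l1norm (f j))) * ((\<Prod>j<p. m' (f j)) - (\<Prod>j<p. m (f j)))"
      using norm_prod_diff_majorant[of "{..<p}" "\<lambda>j. a (f j)" "\<lambda>j. b (f j)"
        "\<lambda>j. exp (- s * l1norm (f j))" "\<lambda>j. m' (f j)" "\<lambda>j. m (f j)"] ab b by blast
    also have "\<dots> \<le> exp (- s * l1norm n) * ((\<Prod>j<p. m' (f j)) - (\<Prod>j<p. m (f j)))"
      by (intro mult_right_mono prod_exp_l1norm_le that s) (auto intro!: prod_mono simp: m)
    finally show ?thesis .
  qed
  have sums: "((\<lambda>f. \<Prod>j<p. b (f j)) has_sum conv_power p b n) (tuples p n)"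
    if "(\<lambda>n. norm (b n)) summable_on UNIV" for b :: "int^'n \<Rightarrow> 'a::{real_normed_field, banach}"
    unfolding conv_power_def by (intro has_sum_infsum tuples_summable that)
  have "((\<lambda>f. (\<Prod>j<p. a (f j)) - (\<Prod>j<p. b (f j))) has_sum (conv_power p a n - conv_power p b n)) (tuples p n)"
    by (intro has_sum_diff sums as bs)
  moreover have "((\<lambda>f. exp (- s * l1norm n) * ((\<Prod>j<p. m' (f j)) - (\<Prod>j<p. m (f j))))
      has_sum (exp (- s * l1norm n) * (conv_power p m' n - conv_power p m n))) (tuples p n)"
    by (intro has_sum_cmult_right has_sum_diff sums m's)
  ultimately show ?thesis by (rule norm_infsum_le) (rule le)
qed

lemma conv_power_zero: "0 < p \<Longrightarrow> conv_power p (\<lambda>_. 0) n = 0"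
  unfolding conv_power_def by (simp add: power_0_left)

text \<open>The comparison of \<open>a\<close> with the zero sequence in
  \<open>conv_power_majorant\<close>; for positive \<open>p\<close> the zero sequence has zero
  convolution power.\<close>

lemma norm_conv_power_le:
  fixes a :: "int^'n \<Rightarrow> complex" and m :: "int^'n \<Rightarrow> real"
  assumes "0 \<le> s" "m summable_on UNIV" "0 < p"
    and a: "\<And>n. norm (a n) \<le> exp (- s * l1norm n) * m n"
  shows "norm (conv_power p a n) \<le> exp (- s * l1norm n) * conv_power p m n"
proof -
  have "0 \<le> m n" for n
    using order_trans[OF norm_ge_zero a[of n]] by (simp add: zero_le_mult_iff)
  then show ?thesis
    using conv_power_majorant[of s "\<lambda>_. 0" m a "\<lambda>_. 0" p n] assms by (simp add: conv_power_zero)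
qed

subsection \<open>Infinite sums\<close>

text \<open>The Weierstrass test along the filter of finite subsets: a uniform limit of continuous
  finite sums.\<close>

lemma continuous_on_infsum:
  fixes f :: "'a \<Rightarrow> 'b::topological_space \<Rightarrow> 'c::banach"
  assumes "\<And>i. i \<in> I \<Longrightarrow> continuous_on S (f i)"
    and "\<And>i x. i \<in> I \<Longrightarrow> x \<in> S \<Longrightarrow> norm (f i x) \<le> M i" and "M summable_on I"
  shows "continuous_on S (\<lambda>x. \<Sum>\<^sub>\<infinity>i\<in>I. f i x)"
proof (rule uniform_limit_theorem)
  show "uniform_limit S (\<lambda>X x. \<Sum>i\<in>X. f i x) (\<lambda>x. \<Sum>\<^sub>\<infinity>i\<in>I. f i x) (finite_subsets_at_top I)"
    using assms(2,3) by (rule Weierstrass_m_test_general)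
  show "\<forall>\<^sub>F X in finite_subsets_at_top I. continuous_on S (\<lambda>x. \<Sum>i\<in>X. f i x)"
    by (rule eventually_finite_subsets_at_top_weakI) (auto intro!: continuous_on_sum assms(1))
qed auto

lemma continuous_on_conv_power:
  fixes a :: "real \<Rightarrow> int^'n \<Rightarrow> complex"
  assumes "\<And>n. continuous_on S (\<lambda>t. a t n)" and "\<And>t n. t \<in> S \<Longrightarrow> norm (a t n) \<le> m n"
    and "m summable_on UNIV" "\<And>n. 0 \<le> m n"
  shows "continuous_on S (\<lambda>t. conv_power p (a t) n)"
  unfolding conv_power_def
proof (rule continuous_on_infsum)
  show "(\<lambda>f. \<Prod>j<p. m (f j)) summable_on tuples p n"
    by (rule tuples_summable) (use assms in simp)
qed (auto intro!: continuous_on_prod assms prod_mono simp: prod_norm[symmetric])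

text \<open>The index type is enumerated by the naturals so that differentiation of series applies;
  the bounds \<open>M\<close> and \<open>M'\<close> identify the unordered sums with the series. A
  general convex \<open>S\<close> covers both the whole line in space and a closed time interval
  with one-sided derivatives at its ends.\<close>

lemma has_vector_derivative_infsum:
  fixes f :: "'a::countable \<Rightarrow> real \<Rightarrow> 'b::banach"
  assumes "infinite (UNIV :: 'a set)" and "convex S"
    and f': "\<And>n x. x \<in> S \<Longrightarrow> (f n has_vector_derivative f' n x) (at x within S)"
    and M': "\<And>n x. x \<in> S \<Longrightarrow> norm (f' n x) \<le> M' n" "M' summable_on UNIV"
    and M: "\<And>n x. x \<in> S \<Longrightarrow> norm (f n x) \<le> M n" "M summable_on UNIV"
    and "x \<in> S"
  shows "((\<lambda>x. \<Sum>\<^sub>\<infinity>n. f n x) has_vector_derivative (\<Sum>\<^sub>\<infinity>n. f' n x)) (at x within S)"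
proof -
  define g :: "nat \<Rightarrow> 'a" where "g = from_nat_into UNIV"
  have bij: "bij_betw g UNIV UNIV"
    unfolding g_def using assms(1) by (intro bij_betw_from_nat_into) auto
  have sums: "(\<lambda>i. h (g i)) sums (\<Sum>\<^sub>\<infinity>n. h n)"
    if "\<And>n. norm (h n) \<le> K n" "K summable_on UNIV" for h :: "'a \<Rightarrow> 'b" and K
  proof -
    have "h summable_on UNIV"
      by (rule abs_summable_summable, rule summable_on_comparison_test[OF that(2)]) (use that in auto)
    then have "((\<lambda>i. h (g i)) has_sum (\<Sum>\<^sub>\<infinity>n. h n)) UNIV"
      using has_sum_reindex_bij_betw[OF bij] by (metis has_sum_infsum)
    then show ?thesis by (rule has_sum_imp_sums)
  qed
  have sK: "summable (\<lambda>i. M' (g i))"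
    using M'(2) summable_on_reindex_bij_betw[OF bij, of M']
    by (simp add: summable_on_imp_summable)
  have f's: "(\<lambda>i. f' (g i) y) sums (\<Sum>\<^sub>\<infinity>n. f' n y)" if "y \<in> S" for y
    using that M' by (intro sums[of _ M']) auto
  have fs: "(\<lambda>i. f (g i) y) sums (\<Sum>\<^sub>\<infinity>n. f n y)" if "y \<in> S" for y
    using that M by (intro sums[of _ M]) auto
  have "\<exists>G. \<forall>x\<in>S. (\<lambda>i. f (g i) x) sums G x \<and>
      (G has_derivative (\<lambda>h. h *\<^sub>R (\<Sum>\<^sub>\<infinity>n. f' n x))) (at x within S)"
  proof (rule has_derivative_series[where f = "\<lambda>i. f (g i)" and f' = "\<lambda>i y h. h *\<^sub>R f' (g i) y",
      OF \<open>convex S\<close> _ _ \<open>x \<in> S\<close> fs[OF \<open>x \<in> S\<close>]])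
    show "(f (g i) has_derivative (\<lambda>h. h *\<^sub>R f' (g i) y)) (at y within S)" if "y \<in> S" for i y
      using f'[OF that] by (simp add: has_vector_derivative_def)
    show "\<forall>\<^sub>F n in sequentially. \<forall>x\<in>S. \<forall>h.
        norm ((\<Sum>i<n. h *\<^sub>R f' (g i) x) - h *\<^sub>R (\<Sum>\<^sub>\<infinity>n. f' n x)) \<le> e * norm h" if "e > 0" for e
    proof -
      have "uniform_limit S (\<lambda>n x. \<Sum>i<n. f' (g i) x) (\<lambda>x. \<Sum>i. f' (g i) x) sequentially"
        by (rule Weierstrass_m_test[OF _ sK]) (use M' in auto)
      from uniform_limitD[OF this \<open>e > 0\<close>] show ?thesis
      proof (rule eventually_mono, intro ballI allI)
        fix n x h assume *: "\<forall>x\<in>S. dist (\<Sum>i<n. f' (g i) x) (\<Sum>i. f' (g i) x) < e" and "x \<in> S"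
        then have "norm ((\<Sum>i<n. f' (g i) x) - (\<Sum>\<^sub>\<infinity>n. f' n x)) \<le> e"
          using f's[OF \<open>x \<in> S\<close>] by (auto simp: sums_iff dist_norm less_imp_le)
        then have "\<bar>h\<bar> * norm ((\<Sum>i<n. f' (g i) x) - (\<Sum>\<^sub>\<infinity>n. f' n x)) \<le> \<bar>h\<bar> * e"
          by (intro mult_left_mono) auto
        then show "norm ((\<Sum>i<n. h *\<^sub>R f' (g i) x) - h *\<^sub>R (\<Sum>\<^sub>\<infinity>n. f' n x)) \<le> e * norm h"
          by (simp add: scaleR_sum_right[symmetric] scaleR_diff_right[symmetric] mult.commute)
      qed
    qed
  qed
  then obtain G where G: "\<And>y. y \<in> S \<Longrightarrow> (\<lambda>i. f (g i) y) sums G y"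
    "(G has_derivative (\<lambda>h. h *\<^sub>R (\<Sum>\<^sub>\<infinity>n. f' n x))) (at x within S)"
    using \<open>x \<in> S\<close> by blast
  have "G y = (\<Sum>\<^sub>\<infinity>n. f n y)" if "y \<in> S" for y
    using G(1) fs that sums_unique2 by blast
  then show ?thesis
    unfolding has_vector_derivative_def
    using has_derivative_transform[OF \<open>x \<in> S\<close> _ G(2)] by simp
qed

text \<open>The sum is \<open>1 + 2 * q / (1 - q)\<close> with \<open>q = exp (- s)\<close>. The
  inequality \<open>1 + s \<le> exp s\<close> bounds \<open>q / (1 - q)\<close> by
  \<open>1 / s\<close>, and \<open>s \<le> 1\<close> bounds the remaining 1 by \<open>1 / s\<close>
  as well.\<close>

lemma infsum_exp_abs_int:
  fixes s :: real
  assumes "0 < s" "s \<le> 1"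
  shows "(\<lambda>k::int. exp (- s * \<bar>of_int k\<bar>)) summable_on UNIV"
    and "(\<Sum>\<^sub>\<infinity>k::int. exp (- s * \<bar>of_int k\<bar>)) \<le> 3 / s"
proof -
  let ?f = "\<lambda>k::int. exp (- s * \<bar>of_int k\<bar>)"
  define q where "q = exp (- s)"
  have q: "0 < q" "q < 1" using assms by (auto simp: q_def)
  \<comment> \<open>The series starts at the first power, since zero is counted separately from the
    two half-lines.\<close>
  have geo: "((\<lambda>i. q ^ Suc i) has_sum (q / (1 - q))) UNIV"
  proof (rule sums_nonneg_imp_has_sum)
    show "(\<lambda>i. q ^ Suc i) sums (q / (1 - q))"
      using geometric_sums[of q] q sums_mult[of "\<lambda>i. q ^ i" "1 / (1 - q)" q] by simp
  qed (use q in auto)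
  have fq: "?f (int (Suc i)) = q ^ Suc i" "?f (- int (Suc i)) = q ^ Suc i" for i
    by (auto simp: q_def exp_of_nat_mult[symmetric] algebra_simps mult_exp_exp)
  have bp: "bij_betw (\<lambda>i. int (Suc i)) UNIV {0<..}"
    by (rule bij_betw_byWitness[where f' = "\<lambda>k. nat k - 1"]) auto
  have bn: "bij_betw (\<lambda>i. - int (Suc i)) UNIV {..<0}"
    by (rule bij_betw_byWitness[where f' = "\<lambda>k. nat (- k) - 1"]) auto
  have p: "(?f has_sum (q / (1 - q))) {0<..}"
    using has_sum_reindex_bij_betw[OF bp, of ?f] geo by (simp only: fq)
  have n: "(?f has_sum (q / (1 - q))) {..<0}"
    using has_sum_reindex_bij_betw[OF bn, of ?f] geo by (simp only: fq)
  have z: "(?f has_sum 1) {0}"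
    using has_sum_finite[of "{0::int}" ?f] by simp
  have "(?f has_sum (q / (1 - q) + 1)) ({..<0} \<union> {0})"
    by (rule has_sum_Un_disjoint[OF n z]) auto
  then have "(?f has_sum (q / (1 - q) + 1 + q / (1 - q))) (({..<0} \<union> {0}) \<union> {0<..})"
    by (rule has_sum_Un_disjoint[OF _ p]) auto
  moreover have "({..<0} \<union> {0}) \<union> {0<..} = (UNIV :: int set)" by auto
  ultimately have hs: "(?f has_sum (q / (1 - q) + 1 + q / (1 - q))) UNIV" by simp
  then show "?f summable_on UNIV" by (rule has_sum_imp_summable)
  have "1 + s \<le> exp s" by simp
  then have "q * (1 + s) \<le> 1"
    unfolding q_def by (metis exp_minus_inverse mult.commute mult_left_mono exp_ge_zero)
  then have "q / (1 - q) \<le> 1 / s"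
    using q assms by (simp add: divide_simps algebra_simps)
  then have "q / (1 - q) + 1 + q / (1 - q) \<le> 1 / s + 1 / s + 1 / s"
    using assms by (intro add_mono) simp_all
  then show "(\<Sum>\<^sub>\<infinity>k. ?f k) \<le> 3 / s" using infsumI[OF hs] by simp
qed

text \<open>The weight is a product over coordinates, so its sum is a power of the one-dimensional
  sum. A rate near \<open>\<kappa> / 2\<close> gives the factor \<open>6 / \<kappa>\<close> per
  dimension that appears in \<open>Box\<close>.\<close>

lemma infsum_exp_l1norm:
  fixes s :: real
  assumes "0 < s" "s \<le> 1"
  shows "(\<lambda>n::int^'n. exp (- s * l1norm n)) summable_on UNIV"
    and "(\<Sum>\<^sub>\<infinity>n::int^'n. exp (- s * l1norm n)) \<le> (3 / s) ^ CARD('n)"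
proof -
  let ?e = "\<lambda>k::int. exp (- s * \<bar>of_int k\<bar>)"
  have bij: "bij_betw (vec_lambda :: ('n \<Rightarrow> int) \<Rightarrow> _) (UNIV \<rightarrow>\<^sub>E UNIV) UNIV"
    by (rule bij_betw_byWitness[where f' = vec_nth]) auto
  have e: "exp (- s * l1norm (vec_lambda g)) = (\<Prod>i\<in>UNIV. ?e (g i))" for g :: "'n \<Rightarrow> int"
    by (simp add: exp_sum[symmetric] l1norm_def sum_distrib_left)
  have s1: "(\<lambda>k. norm (?e k)) summable_on UNIV" using infsum_exp_abs_int[OF assms] by simp
  have "(\<lambda>g. \<Prod>i\<in>UNIV. ?e (g i)) summable_on ((UNIV::'n set) \<rightarrow>\<^sub>E UNIV)"
    by (rule abs_summable_summable, rule norm_prod_summable_PiE) (use s1 in auto)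
  then show "(\<lambda>n::int^'n. exp (- s * l1norm n)) summable_on UNIV"
    using summable_on_reindex_bij_betw[OF bij, of "\<lambda>n. exp (- s * l1norm n)"] by (simp only: e)
  have "(\<Sum>\<^sub>\<infinity>n::int^'n. exp (- s * l1norm n)) = (\<Sum>\<^sub>\<infinity>g\<in>(UNIV::'n set) \<rightarrow>\<^sub>E UNIV. \<Prod>i\<in>UNIV. ?e (g i))"
    using infsum_reindex_bij_betw[OF bij, of "\<lambda>n. exp (- s * l1norm n)"] by (simp only: e)
  also have "\<dots> = (\<Sum>\<^sub>\<infinity>k. ?e k) ^ CARD('n)"
    using infsum_prod_PiE_abs[of "UNIV :: 'n set" "\<lambda>_. ?e" "\<lambda>_. UNIV"] s1 by simp
  also have "\<dots> \<le> (3 / s) ^ CARD('n)"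
    by (intro power_mono infsum_exp_abs_int assms infsum_nonneg) auto
  finally show "(\<Sum>\<^sub>\<infinity>n::int^'n. exp (- s * l1norm n)) \<le> (3 / s) ^ CARD('n)" .
qed

subsection \<open>Duhamel iteration and majorants\<close>

lemma exp_ii_has_vector_derivative:
  "((\<lambda>s. exp (\<i> * of_real (r * s))) has_vector_derivative
      \<i> * of_real r * exp (\<i> * of_real (r * t))) (at t within S)"
proof -
  have "((\<lambda>z. exp (\<i> * of_real r * z)) has_field_derivative
      \<i> * of_real r * exp (\<i> * of_real r * of_real t)) (at (of_real t))"
    by (auto intro!: derivative_eq_intros)
  from has_vector_derivative_real_field[OF this] show ?thesis by (simp add: mult_ac)
qed

text \<open>With the phase in \<open>t\<close> pulled out, \<open>t\<close> enters the integral only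
  as its upper limit, so the product rule and the fundamental theorem of calculus apply.\<close>

lemma duhamel_factor:
  "duhamel p \<omega> c a t n = exp (\<i> * of_real ((dotw n \<omega>)^3 * t)) *
     (c n - (\<i> * of_real (dotw n \<omega>) / of_nat p) *
        integral {0..t} (\<lambda>\<tau>. exp (- (\<i> * of_real ((dotw n \<omega>)^3 * \<tau>))) * conv p (a \<tau>) n))"
proof -
  have "duhamel_integrand p \<omega> a t n = (\<lambda>\<tau>. exp (\<i> * of_real ((dotw n \<omega>)^3 * t)) *
      (exp (- (\<i> * of_real ((dotw n \<omega>)^3 * \<tau>))) * conv p (a \<tau>) n))"
    by (simp add: fun_eq_iff duhamel_integrand_def exp_diff exp_minus divide_inverse
        right_diff_distrib del: of_real_mult of_real_power)
  then have I: "integral {0..t} (duhamel_integrand p \<omega> a t n) = exp (\<i> * of_real ((dotw n \<omega>)^3 * t)) *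
      integral {0..t} (\<lambda>\<tau>. exp (- (\<i> * of_real ((dotw n \<omega>)^3 * \<tau>))) * conv p (a \<tau>) n)"
    by (simp only: integral_mult_right)
  show ?thesis
    unfolding duhamel_def I by (simp only: right_diff_distrib mult.left_commute)
qed

lemma continuous_on_duhamel_integrand:
  assumes "continuous_on S (\<lambda>\<tau>. conv p (a \<tau>) n)"
  shows "continuous_on S (duhamel_integrand p \<omega> a t n)"
  unfolding duhamel_integrand_def[abs_def] by (intro continuous_intros assms)

text \<open>Duhamel's formula solves a linear ordinary differential equation for each frequency.
  This gives continuity of the iterates and, at the fixed point, the time derivative of each Fourier
  coefficient.\<close>

lemma duhamel_has_vector_derivative:
  assumes conv: "continuous_on {0..T} (\<lambda>\<tau>. conv p (a \<tau>) n)" and t: "t \<in> {0..T}"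
  shows "((\<lambda>t. duhamel p \<omega> c a t n) has_vector_derivative
      (\<i> * of_real ((dotw n \<omega>)^3) * duhamel p \<omega> c a t n
       - (\<i> * of_real (dotw n \<omega>) / of_nat p) * conv p (a t) n)) (at t within {0..T})"
proof -
  define E where "E s = exp (\<i> * of_real ((dotw n \<omega>)^3 * s))" for s
  define g where "g s = exp (- (\<i> * of_real ((dotw n \<omega>)^3 * s))) * conv p (a s) n" for s
  let ?k = "\<i> * of_real (dotw n \<omega>) / of_nat p :: complex"
  have "continuous_on {0..T} g"
    unfolding g_def by (intro continuous_intros conv)
  then have g: "((\<lambda>s. integral {0..s} g) has_vector_derivative g t) (at t within {0..T})"
    using t by (rule integral_has_vector_derivative)
  have E: "(E has_vector_derivative (\<i> * of_real ((dotw n \<omega>)^3) * E t)) (at t within {0..T})"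
    unfolding E_def by (rule exp_ii_has_vector_derivative)
  have Eg: "E t * g t = conv p (a t) n"
    by (simp add: E_def g_def exp_minus)
  have "((\<lambda>s. E s * (c n - ?k * integral {0..s} g)) has_vector_derivative
      (E t * (0 - ?k * g t) + (\<i> * of_real ((dotw n \<omega>)^3) * E t) * (c n - ?k * integral {0..t} g)))
      (at t within {0..T})"
    by (intro has_vector_derivative_mult E has_vector_derivative_diff has_vector_derivative_const
        has_vector_derivative_mult_right g)
  also have "E t * (0 - ?k * g t) + (\<i> * of_real ((dotw n \<omega>)^3) * E t) * (c n - ?k * integral {0..t} g)
    = \<i> * of_real ((dotw n \<omega>)^3) * (E t * (c n - ?k * integral {0..t} g)) - ?k * (E t * g t)"
    by (simp add: algebra_simps)
  finally show ?thesis
    unfolding Eg unfolding duhamel_factor[abs_def] E_def g_def .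
qed

lemma continuous_on_duhamel:
  assumes "continuous_on {0..T} (\<lambda>\<tau>. conv p (a \<tau>) n)"
  shows "continuous_on {0..T} (\<lambda>t. duhamel p \<omega> c a t n)"
  using duhamel_has_vector_derivative[of T p a n, OF assms]
  by (rule continuous_on_vector_derivative)

text \<open>Letting the exponential weight lose decay at rate \<open>L\<close> in time absorbs the factor \<open>k\<close>
  that comes from the derivative in the nonlinearity.\<close>

lemma has_integral_exp_weight:
  fixes L :: real
  assumes "0 < L" "0 \<le> t"
  shows "((\<lambda>\<tau>. k * exp (- (\<sigma> - L * \<tau>) * k)) has_integral
      (exp (- (\<sigma> - L * t) * k) / L - exp (- \<sigma> * k) / L)) {0..t}"
proof -
  have "((\<lambda>\<tau>. k * exp (- (\<sigma> - L * \<tau>) * k)) has_integral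
      (exp (- (\<sigma> - L * t) * k) / L - exp (- (\<sigma> - L * 0) * k) / L)) {0..t}"
    using assms by (intro fundamental_theorem_of_calculus)
      (auto intro!: derivative_eq_intros simp flip: has_real_derivative_iff_has_vector_derivative)
  then show ?thesis by simp
qed

lemma decay_rate_nonneg:
  fixes L :: real
  assumes "t \<in> {0..T}" "0 < L" "L * T \<le> \<sigma>"
  shows "0 \<le> \<sigma> - L * t"
proof -
  have "L * t \<le> L * T" using assms by (intro mult_left_mono) auto
  then have "L * t \<le> \<sigma>" using assms(3) by (rule order_trans)
  then show ?thesis by simp
qed

lemma exp_weight_le_1:
  fixes L :: real
  assumes "t \<in> {0..T}" "0 < L" "L * T \<le> \<sigma>"
  shows "exp (- (\<sigma> - L * t) * l1norm n) \<le> 1"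
  using mult_nonneg_nonneg[OF decay_rate_nonneg[OF assms] l1norm_nonneg[of n]]
  unfolding mult_minus_left exp_le_one_iff neg_le_0_iff_le .

text \<open>The symbol \<open>dotw n \<omega>\<close> costs at most
  \<open>norm \<omega> * l1norm n\<close>, while integrating \<open>l1norm n\<close> times the
  weight over time yields at most the weight at time \<open>t\<close> divided by \<open>L\<close>.
  The factor \<open>l1norm n\<close> thus disappears and leaves the constant
  \<open>norm \<omega> / (real p * L)\<close>.\<close>

lemma duhamel_diff_le:
  fixes a b :: "real \<Rightarrow> int^'n \<Rightarrow> complex" and m m' :: "int^'n \<Rightarrow> real"
  assumes p: "0 < p" and L: "0 < L" and LT: "L * T \<le> \<sigma>" and t: "t \<in> {0..T}"
    and m: "\<And>n. 0 \<le> m n" "\<And>n. m n \<le> m' n" "m' summable_on UNIV"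
    and cont: "\<And>n. continuous_on {0..T} (\<lambda>\<tau>. a \<tau> n)" "\<And>n. continuous_on {0..T} (\<lambda>\<tau>. b \<tau> n)"
    and ab: "\<And>\<tau> n. \<tau> \<in> {0..T} \<Longrightarrow>
        norm (a \<tau> n - b \<tau> n) \<le> exp (- (\<sigma> - L * \<tau>) * l1norm n) * (m' n - m n)"
    and b: "\<And>\<tau> n. \<tau> \<in> {0..T} \<Longrightarrow> norm (b \<tau> n) \<le> exp (- (\<sigma> - L * \<tau>) * l1norm n) * m n"
  shows "norm (duhamel p \<omega> c a t n - duhamel p \<omega> c b t n)
      \<le> exp (- (\<sigma> - L * t) * l1norm n) * (norm \<omega> / (real p * L) * (conv_power p m' n - conv_power p m n))"
proof -
  let ?k = "l1norm n" and ?D = "conv_power p m' n - conv_power p m n"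
  let ?fa = "duhamel_integrand p \<omega> a t n" and ?fb = "duhamel_integrand p \<omega> b t n"
  have s0: "0 \<le> \<sigma> - L * \<tau>" if "\<tau> \<in> {0..T}" for \<tau>
    using decay_rate_nonneg[OF that L LT] .
  have e1: "exp (- (\<sigma> - L * \<tau>) * l1norm n) \<le> 1" if "\<tau> \<in> {0..T}" for \<tau> and n :: "int^'n"
    using that L LT by (rule exp_weight_le_1)
  have m'0: "0 \<le> m' n" for n using m order_trans by blast
  have a: "norm (a \<tau> n) \<le> exp (- (\<sigma> - L * \<tau>) * l1norm n) * m' n" if "\<tau> \<in> {0..T}" for \<tau> n
    using ab[OF that, of n] b[OF that, of n] norm_triangle_sub[of "a \<tau> n" "b \<tau> n"]
    by (simp add: algebra_simps)
  have am: "norm (a \<tau> n) \<le> m' n" and bm: "norm (b \<tau> n) \<le> m' n" if "\<tau> \<in> {0..T}" for \<tau> n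
    using a[OF that, of n] b[OF that, of n] mult_right_mono[OF e1[OF that, of n] m'0[of n]]
      mult_right_mono[OF e1[OF that, of n] m(1)[of n]] m(2)[of n] by auto
  have c': "continuous_on {0..T} (\<lambda>\<tau>. conv p (a \<tau>) n)" "continuous_on {0..T} (\<lambda>\<tau>. conv p (b \<tau>) n)"
    unfolding conv_eq_conv_power using am bm
    by (auto intro!: continuous_on_conv_power[where m = m'] cont m m'0)
  have sub: "{0..t} \<subseteq> {0..T}" using t by auto
  have int: "?fa integrable_on {0..t}" "?fb integrable_on {0..t}"
    using c' sub by (auto intro!: integrable_continuous_real continuous_on_duhamel_integrand
        intro: continuous_on_subset)
  have "norm (?fa \<tau> - ?fb \<tau>) \<le> exp (- (\<sigma> - L * \<tau>) * ?k) * ?D" if "\<tau> \<in> {0..t}" for \<tau>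
  proof -
    have \<tau>: "\<tau> \<in> {0..T}" using that sub by auto
    have "?fa \<tau> - ?fb \<tau> = exp (\<i> * of_real ((dotw n \<omega>)^3 * (t - \<tau>))) * (conv_power p (a \<tau>) n - conv_power p (b \<tau>) n)"
      by (simp add: duhamel_integrand_def conv_eq_conv_power algebra_simps)
    then have "norm (?fa \<tau> - ?fb \<tau>) = norm (conv_power p (a \<tau>) n - conv_power p (b \<tau>) n)"
      by (simp add: norm_mult)
    also have "\<dots> \<le> exp (- (\<sigma> - L * \<tau>) * ?k) * ?D"
      by (intro conv_power_majorant s0 m ab b \<tau>)
    finally show ?thesis .
  qed
  \<comment> \<open>Multiplying by \<open>l1norm n\<close> under the integral, instead of dividing
    by it afterwards, includes the frequency zero.\<close>
  then have le: "norm (?k *\<^sub>R (?fa \<tau> - ?fb \<tau>)) \<le> ?k * exp (- (\<sigma> - L * \<tau>) * ?k) * ?D" if "\<tau> \<in> {0..t}" for \<tau>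
    using mult_left_mono[OF _ l1norm_nonneg[of n]] that by (simp add: mult.assoc l1norm_nonneg)
  have hi: "((\<lambda>\<tau>. ?k * exp (- (\<sigma> - L * \<tau>) * ?k) * ?D) has_integral
      ((exp (- (\<sigma> - L * t) * ?k) / L - exp (- \<sigma> * ?k) / L) * ?D)) {0..t}"
    using t by (intro has_integral_mult_left has_integral_exp_weight L) auto
  have D: "0 \<le> ?D" using conv_power_mono[of m m' p n] m by simp
  have "?k * norm (integral {0..t} ?fa - integral {0..t} ?fb)
      = norm (integral {0..t} (\<lambda>\<tau>. ?k *\<^sub>R (?fa \<tau> - ?fb \<tau>)))"
    using int l1norm_nonneg[of n] by (simp add: integral_diff)
  also have "\<dots> \<le> integral {0..t} (\<lambda>\<tau>. ?k * exp (- (\<sigma> - L * \<tau>) * ?k) * ?D)"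
    using int hi le by (intro integral_norm_bound_integral integrable_cmul integrable_diff) auto
  also have "\<dots> = (exp (- (\<sigma> - L * t) * ?k) / L - exp (- \<sigma> * ?k) / L) * ?D"
    using hi by (rule integral_unique)
  also have "\<dots> \<le> exp (- (\<sigma> - L * t) * ?k) / L * ?D"
    using L by (intro mult_right_mono D) simp
  finally have I: "?k * norm (integral {0..t} ?fa - integral {0..t} ?fb)
      \<le> exp (- (\<sigma> - L * t) * ?k) / L * ?D" .
  have "norm (duhamel p \<omega> c a t n - duhamel p \<omega> c b t n)
      = \<bar>dotw n \<omega>\<bar> / real p * norm (integral {0..t} ?fa - integral {0..t} ?fb)"
  proof -
    have "(x - K * u) - (x - K * v) = - (K * (u - v))" for x K u v :: complex
      by (simp add: algebra_simps)
    then show ?thesis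
      by (simp only: duhamel_def norm_minus_cancel norm_mult norm_divide) simp
  qed
  also have "\<dots> \<le> (norm \<omega> * ?k) / real p * norm (integral {0..t} ?fa - integral {0..t} ?fb)"
    by (intro mult_right_mono divide_right_mono abs_dotw_le) auto
  also have "\<dots> = norm \<omega> / real p * (?k * norm (integral {0..t} ?fa - integral {0..t} ?fb))" by simp
  also have "\<dots> \<le> norm \<omega> / real p * (exp (- (\<sigma> - L * t) * ?k) / L * ?D)"
    by (intro mult_left_mono I) auto
  finally show ?thesis by (simp add: mult_ac)
qed

text \<open>Monotone convergence. The limit \<open>l\<close> of the increasing convolution powers is
  at most that of \<open>\<mu>\<close>; conversely every finite partial sum for \<open>\<mu>\<close>
  is a limit of finite sums bounded by \<open>l\<close>.\<close>

lemma conv_power_tendsto_mono: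
  fixes m :: "nat \<Rightarrow> int^'n \<Rightarrow> real"
  assumes nn: "\<And>k n. 0 \<le> m k n" and inc: "\<And>k n. m k n \<le> m (Suc k) n"
    and lim: "\<And>n. (\<lambda>k. m k n) \<longlonglongrightarrow> \<mu> n" and \<mu>: "\<mu> summable_on UNIV"
  shows "(\<lambda>k. conv_power p (m k) n) \<longlonglongrightarrow> conv_power p \<mu> n"
proof -
  have le: "m k n \<le> \<mu> n" for k n
    using lim by (intro incseq_le) (auto intro: incseq_SucI inc)
  have \<mu>0: "0 \<le> \<mu> n" for n using nn le order_trans by blast
  have s: "m k summable_on UNIV" for k
    by (rule summable_on_comparison_test[OF \<mu>]) (use nn le in auto)
  have mono: "incseq (\<lambda>k. conv_power p (m k) n)"
    by (intro incseq_SucI conv_power_mono nn inc s)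
  have "conv_power p (m k) n \<le> conv_power p \<mu> n" for k
    by (intro conv_power_mono nn le \<mu>)
  then obtain l where l: "(\<lambda>k. conv_power p (m k) n) \<longlonglongrightarrow> l" "\<And>k. conv_power p (m k) n \<le> l"
      "l \<le> conv_power p \<mu> n"
    using incseq_convergent[OF mono] by (metis LIMSEQ_le_const2)
  have "conv_power p \<mu> n \<le> l"
    unfolding conv_power_def
  proof (rule infsum_le_finite_sums)
    show "(\<lambda>f. \<Prod>j<p. \<mu> (f j)) summable_on tuples p n"
      by (rule tuples_summable) (use \<mu> \<mu>0 in simp)
    fix F assume F: "finite F" "F \<subseteq> tuples p n"
    have "(\<lambda>k. \<Sum>f\<in>F. \<Prod>j<p. m k (f j)) \<longlonglongrightarrow> (\<Sum>f\<in>F. \<Prod>j<p. \<mu> (f j))"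
      by (intro tendsto_intros lim)
    moreover have "(\<Sum>f\<in>F. \<Prod>j<p. m k (f j)) \<le> l" for k
    proof -
      have "(\<Sum>f\<in>F. \<Prod>j<p. m k (f j)) \<le> conv_power p (m k) n"
        unfolding conv_power_def using F nn s
        by (intro finite_sum_le_infsum tuples_summable) (auto intro!: prod_nonneg)
      with l(2) show ?thesis using order_trans by blast
    qed
    ultimately show "(\<Sum>f\<in>F. \<Prod>j<p. \<mu> (f j)) \<le> l"
      using LIMSEQ_le_const2 by blast
  qed
  with l show ?thesis by simp
qed

text \<open>The smallness assumption below makes \<open>\<Phi>\<close> a bound for the total mass of every majorant.
  The majorants increase with the iteration, and the differences of consecutive Picard iterates
  are dominated by those of the majorants, so convergence needs no contraction estimate.\<close>

locale majorized_picard =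
  fixes p :: nat and \<omega> :: "real^'n" and c :: "int^'n \<Rightarrow> complex"
    and \<sigma> L T \<Phi> :: real and m\<^sub>0 :: "int^'n \<Rightarrow> real"
  assumes p_pos: "0 < p" and L_pos: "0 < L" and LT: "L * T \<le> \<sigma>"
    and c_le: "\<And>n. norm (c n) \<le> exp (- \<sigma> * l1norm n) * m\<^sub>0 n"
    and m\<^sub>0_summable: "m\<^sub>0 summable_on UNIV"
    and \<Phi>_nonneg: "0 \<le> \<Phi>"
    and budget: "(\<Sum>\<^sub>\<infinity>n. m\<^sub>0 n) + norm \<omega> / (real p * L) * \<Phi> ^ p \<le> \<Phi>"
begin

section \<open>The majorants: sign, mass, monotonicity and limit\<close>

primrec majorant :: "nat \<Rightarrow> int^'n \<Rightarrow> real" where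
  "majorant 0 = m\<^sub>0"
| "majorant (Suc k) = (\<lambda>n. m\<^sub>0 n + norm \<omega> / (real p * L) * conv_power p (majorant k) n)"

abbreviation weight :: "real \<Rightarrow> int^'n \<Rightarrow> real" where
  "weight t n \<equiv> exp (- (\<sigma> - L * t) * l1norm n)"

lemma m\<^sub>0_nonneg: "0 \<le> m\<^sub>0 n"
  using order_trans[OF norm_ge_zero c_le[of n]] by (simp add: zero_le_mult_iff)

lemma coeff_nonneg: "0 \<le> norm \<omega> / (real p * L)"
  using L_pos by simp

lemma majorant_nonneg: "0 \<le> majorant k n"
proof (induction k arbitrary: n)
  case (Suc k)
  show ?case unfolding majorant.simps
    by (intro add_nonneg_nonneg mult_nonneg_nonneg coeff_nonneg m\<^sub>0_nonneg conv_power_nonneg Suc.IH)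
qed (simp add: m\<^sub>0_nonneg)

lemma majorant_summable: "majorant k summable_on UNIV"
proof (induction k)
  case (Suc k)
  then show ?case unfolding majorant.simps
    by (intro summable_on_add m\<^sub>0_summable summable_on_cmult_right summable_conv_power)
      (simp add: majorant_nonneg)
qed (simp add: m\<^sub>0_summable)

text \<open>Total masses multiply under convolution, so they follow a scalar recursion, for which
  \<open>budget\<close> says that the interval from 0 to \<open>\<Phi>\<close> is invariant.\<close>

lemma infsum_majorant_le: "(\<Sum>\<^sub>\<infinity>n. majorant k n) \<le> \<Phi>"
proof (induction k)
  case 0
  show ?case
    using budget mult_nonneg_nonneg[OF coeff_nonneg zero_le_power[OF \<Phi>_nonneg, of p]] by simp
next
  case (Suc k)
  have s: "(\<lambda>n. norm (majorant k n)) summable_on UNIV"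
    by (simp add: majorant_nonneg majorant_summable)
  have "(\<Sum>\<^sub>\<infinity>n. majorant (Suc k) n)
      = (\<Sum>\<^sub>\<infinity>n. m\<^sub>0 n) + norm \<omega> / (real p * L) * (\<Sum>\<^sub>\<infinity>n. majorant k n) ^ p"
    unfolding majorant.simps infsum_conv_power[OF s, symmetric]
    by (subst infsum_add) (auto simp: infsum_cmult_right' simp del: times_divide_eq_left
        intro!: m\<^sub>0_summable summable_on_cmult_right summable_conv_power[OF s])
  also have "\<dots> \<le> (\<Sum>\<^sub>\<infinity>n. m\<^sub>0 n) + norm \<omega> / (real p * L) * \<Phi> ^ p"
    by (intro add_left_mono mult_left_mono power_mono Suc.IH coeff_nonneg infsum_nonneg
        majorant_nonneg)
  finally show ?case using budget by simp
qed

lemma majorant_mono: "majorant k n \<le> majorant (Suc k) n"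
proof (induction k arbitrary: n)
  case 0
  show ?case using mult_nonneg_nonneg[OF coeff_nonneg conv_power_nonneg, of m\<^sub>0 p n] m\<^sub>0_nonneg by simp
next
  case (Suc k)
  have "conv_power p (majorant k) n \<le> conv_power p (majorant (Suc k)) n"
    by (rule conv_power_mono[OF majorant_nonneg Suc.IH majorant_summable])
  from mult_left_mono[OF this coeff_nonneg] show ?case
    by simp
qed

text \<open>Finite partial sums are bounded by \<open>\<Phi>\<close> uniformly in \<open>k\<close>.
  Singletons give the pointwise limits, and letting \<open>k\<close> grow in a fixed finite sum
  gives summability with the same bound.\<close>

lemma majorant_limit:
  obtains \<mu> where "\<And>n. (\<lambda>k. majorant k n) \<longlonglongrightarrow> \<mu> n" "\<And>k n. majorant k n \<le> \<mu> n"
    "\<And>n. 0 \<le> \<mu> n" "\<mu> summable_on UNIV" "(\<Sum>\<^sub>\<infinity>n. \<mu> n) \<le> \<Phi>"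
proof -
  have F: "(\<Sum>n\<in>F. majorant k n) \<le> \<Phi>" if "finite F" for F k
    using finite_sum_le_infsum[OF majorant_summable[of k] that] infsum_majorant_le[of k]
    by (auto simp: majorant_nonneg intro: order_trans)
  have inc: "incseq (\<lambda>k. majorant k n)" for n by (intro incseq_SucI majorant_mono)
  have "\<exists>l. (\<lambda>k. majorant k n) \<longlonglongrightarrow> l" for n
    using incseq_convergent[OF inc, of n \<Phi>] F[of "{n}"]
    by (metis finite.emptyI finite.insertI sum.empty sum.insert empty_iff add_0_right)
  then obtain \<mu> where \<mu>: "\<And>n. (\<lambda>k. majorant k n) \<longlonglongrightarrow> \<mu> n" by metis
  have le: "majorant k n \<le> \<mu> n" for k n using incseq_le[OF inc \<mu>] .
  have nn: "0 \<le> \<mu> n" for n using majorant_nonneg[of 0 n] le[of 0 n] by simp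
  have F': "(\<Sum>n\<in>F. \<mu> n) \<le> \<Phi>" if "finite F" for F
    by (rule LIMSEQ_le_const2[of "\<lambda>k. \<Sum>n\<in>F. majorant k n"]) (auto intro!: tendsto_sum \<mu> F that)
  have s: "\<mu> summable_on UNIV"
    by (rule nonneg_bdd_above_summable_on) (auto intro!: nn bdd_aboveI2 F')
  show thesis
    by (rule that[OF \<mu> le nn s infsum_le_finite_sums[OF s F']])
qed

section \<open>Picard iterates controlled by the majorants\<close>

lemma weight_le_1:
  assumes "t \<in> {0..T}"
  shows "weight t n \<le> 1"
  using assms L_pos LT by (rule exp_weight_le_1)

text \<open>Continuity, size and increment go through one induction, because the next increment is
  estimated by \<open>duhamel_diff_le\<close>, which asks for all three.\<close>

lemma picard_majorant:
  "(\<forall>n. continuous_on {0..T} (\<lambda>t. picard p \<omega> c k t n)) \<and>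
   (\<forall>t\<in>{0..T}. \<forall>n. norm (picard p \<omega> c k t n) \<le> weight t n * majorant k n \<and>
     norm (picard p \<omega> c (Suc k) t n - picard p \<omega> c k t n)
       \<le> weight t n * (majorant (Suc k) n - majorant k n))"
proof (induction k)
  case 0
  have cont: "continuous_on {0..T} (\<lambda>t. picard p \<omega> c 0 t n)" for n
    by (auto intro!: continuous_intros)
  have bound: "norm (picard p \<omega> c 0 t n) \<le> weight t n * m\<^sub>0 n" if "t \<in> {0..T}" for t n
  proof -
    have "norm (picard p \<omega> c 0 t n) = norm (c n)" by (simp add: norm_mult)
    also have "\<dots> \<le> exp (- \<sigma> * l1norm n) * m\<^sub>0 n" by (rule c_le)
    also have "\<dots> \<le> weight t n * m\<^sub>0 n"
      using that L_pos mult_right_mono[of "- \<sigma>" "- (\<sigma> - L * t)" "l1norm n"]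
      by (intro mult_right_mono m\<^sub>0_nonneg) (simp add: l1norm_nonneg)
    finally show ?thesis .
  qed
  \<comment> \<open>The zeroth iterate is the Duhamel map applied to zero, so the first increment is
    also an instance of \<open>duhamel_diff_le\<close>, with zero as the smaller majorant.\<close>
  have z: "duhamel p \<omega> c (\<lambda>_ _. 0) t n = picard p \<omega> c 0 t n" for t n
    by (simp add: duhamel_def duhamel_integrand_def[abs_def] conv_eq_conv_power conv_power_zero p_pos)
  have "norm (picard p \<omega> c (Suc 0) t n - picard p \<omega> c 0 t n)
       \<le> weight t n * (majorant (Suc 0) n - majorant 0 n)" if "t \<in> {0..T}" for t n
    using duhamel_diff_le[of p L T \<sigma> t "\<lambda>_. 0" m\<^sub>0 "picard p \<omega> c 0" "\<lambda>_ _. 0" \<omega> c n,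
        OF p_pos L_pos LT that] bound cont
    by (simp add: m\<^sub>0_nonneg m\<^sub>0_summable z conv_power_zero p_pos)
  with cont bound show ?case by simp
next
  case (Suc k)
  let ?a = "picard p \<omega> c (Suc k)" and ?b = "picard p \<omega> c k"
  have cb: "continuous_on {0..T} (\<lambda>t. ?b t n)" for n using Suc by blast
  have b: "norm (?b t n) \<le> weight t n * majorant k n" if "t \<in> {0..T}" for t n
    using Suc that by blast
  have ab: "norm (?a t n - ?b t n) \<le> weight t n * (majorant (Suc k) n - majorant k n)"
    if "t \<in> {0..T}" for t n using Suc that by blast
  have a: "norm (?a t n) \<le> weight t n * majorant (Suc k) n" if "t \<in> {0..T}" for t n
    using ab[OF that, of n] b[OF that, of n] norm_triangle_sub[of "?a t n" "?b t n"]
    by (simp add: right_diff_distrib)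
  have "norm (?b t n) \<le> majorant k n" if "t \<in> {0..T}" for t n
    using b[OF that, of n] mult_right_mono[OF weight_le_1[OF that, of n] majorant_nonneg[of k n]]
    by simp
  then have "continuous_on {0..T} (\<lambda>t. conv p (?b t) n)" for n
    unfolding conv_eq_conv_power
    by (rule continuous_on_conv_power[OF cb _ majorant_summable majorant_nonneg])
  then have ca: "continuous_on {0..T} (\<lambda>t. ?a t n)" for n
    unfolding picard.simps by (rule continuous_on_duhamel)
  have "norm (picard p \<omega> c (Suc (Suc k)) t n - ?a t n)
      \<le> weight t n * (majorant (Suc (Suc k)) n - majorant (Suc k) n)" if "t \<in> {0..T}" for t n
    using duhamel_diff_le[of p L T \<sigma> t "majorant k" "majorant (Suc k)" ?a ?b \<omega> c n,
        OF p_pos L_pos LT that majorant_nonneg majorant_mono majorant_summable ca cb ab b]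
    unfolding picard.simps(2)[symmetric] majorant.simps(2)[of "Suc k"] majorant.simps(2)[of k]
    by (simp add: right_diff_distrib)
  with a ca show ?case by blast
qed

lemmas continuous_picard = picard_majorant[THEN conjunct1, rule_format]
lemmas norm_picard_le = picard_majorant[THEN conjunct2, rule_format, THEN conjunct1]
lemmas norm_picard_Suc_diff_le = picard_majorant[THEN conjunct2, rule_format, THEN conjunct2]

lemma norm_picard_diff_le:
  assumes "t \<in> {0..T}"
  shows "norm (picard p \<omega> c (k + i) t n - picard p \<omega> c k t n)
    \<le> weight t n * (majorant (k + i) n - majorant k n)"
proof (induction i)
  case (Suc i)
  have "norm (picard p \<omega> c (k + Suc i) t n - picard p \<omega> c k t n)
      \<le> norm (picard p \<omega> c (Suc (k + i)) t n - picard p \<omega> c (k + i) t n)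
        + norm (picard p \<omega> c (k + i) t n - picard p \<omega> c k t n)"
    using norm_triangle_ineq[of "picard p \<omega> c (Suc (k + i)) t n - picard p \<omega> c (k + i) t n"
      "picard p \<omega> c (k + i) t n - picard p \<omega> c k t n"] by simp
  also have "\<dots> \<le> weight t n * (majorant (Suc (k + i)) n - majorant (k + i) n)
        + weight t n * (majorant (k + i) n - majorant k n)"
    by (intro add_mono norm_picard_Suc_diff_le Suc.IH assms)
  finally show ?case by (simp add: right_diff_distrib del: majorant.simps)
qed simp

text \<open>The tails \<open>\<mu> n - majorant k n\<close> control the iterates uniformly in time.
  This makes them Cauchy and their limit continuous, and the same control of the Duhamel images
  identifies the limit as a fixed point.\<close>

theorem picard_limit:
  obtains cd \<mu> where
    "\<mu> summable_on UNIV" "(\<Sum>\<^sub>\<infinity>n. \<mu> n) \<le> \<Phi>" "\<And>n. 0 \<le> \<mu> n"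
    "\<And>n. continuous_on {0..T} (\<lambda>t. cd t n)"
    "\<And>t n. t \<in> {0..T} \<Longrightarrow> norm (cd t n) \<le> exp (- (\<sigma> - L * t) * l1norm n) * \<mu> n"
    "\<And>t n. t \<in> {0..T} \<Longrightarrow> cd t n = duhamel p \<omega> c cd t n"
    "\<And>t n. t \<in> {0..T} \<Longrightarrow> (\<lambda>k. picard p \<omega> c k t n) \<longlonglongrightarrow> cd t n"
proof -
  obtain \<mu> where \<mu>: "\<And>n. (\<lambda>k. majorant k n) \<longlonglongrightarrow> \<mu> n" "\<And>k n. majorant k n \<le> \<mu> n"
    "\<And>n. 0 \<le> \<mu> n" "\<mu> summable_on UNIV" "(\<Sum>\<^sub>\<infinity>n. \<mu> n) \<le> \<Phi>"
    using majorant_limit by blast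
  have diff: "norm (picard p \<omega> c (k + i) t n - picard p \<omega> c k t n) \<le> weight t n * (\<mu> n - majorant k n)"
    if "t \<in> {0..T}" for k i t n
    using norm_picard_diff_le[OF that, of k i n] \<mu>(2)[of "k + i" n]
    by (rule_tac order_trans) auto
  have gap: "(\<lambda>k. \<mu> n - majorant k n) \<longlonglongrightarrow> 0" for n
    using tendsto_diff[OF tendsto_const \<mu>(1), of "\<mu> n" n] by simp
  have diff1: "norm (picard p \<omega> c (k + i) t n - picard p \<omega> c k t n) \<le> \<mu> n - majorant k n"
    if "t \<in> {0..T}" for k i t n
    using diff[OF that, of k i n] mult_right_mono[OF weight_le_1[OF that, of n], of "\<mu> n - majorant k n"]
      \<mu>(2)[of k n] by simp
  have "convergent (\<lambda>k. picard p \<omega> c k t n)" if "t \<in> {0..T}" for t n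
  proof (rule Cauchy_convergent, rule CauchyI')
    fix e :: real assume "e > 0"
    then obtain M where M: "\<And>k. k \<ge> M \<Longrightarrow> norm (\<mu> n - majorant k n - 0) < e"
      using LIMSEQ_D[OF gap] by blast
    have "norm (picard p \<omega> c k t n - picard p \<omega> c l t n) < e" if "M \<le> k" "k < l" for k l
      using diff1[OF \<open>t \<in> {0..T}\<close>, of k "l - k" n] M[OF that(1)] that(2)
      by (simp add: norm_minus_commute)
    then show "\<exists>M. \<forall>k\<ge>M. \<forall>l>k. dist (picard p \<omega> c k t n) (picard p \<omega> c l t n) < e"
      unfolding dist_norm by blast
  qed
  then have lim: "(\<lambda>k. picard p \<omega> c k t n) \<longlonglongrightarrow> lim (\<lambda>k. picard p \<omega> c k t n)" if "t \<in> {0..T}" for t n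
    using that convergent_LIMSEQ_iff by blast
  define cd where "cd t n = lim (\<lambda>k. picard p \<omega> c k t n)" for t n
  note lim = lim[folded cd_def]
  have cd_diff: "norm (cd t n - picard p \<omega> c k t n) \<le> weight t n * (\<mu> n - majorant k n)"
    if "t \<in> {0..T}" for k t n
  proof (rule LIMSEQ_le_const2)
    show "(\<lambda>i. norm (picard p \<omega> c (k + i) t n - picard p \<omega> c k t n)) \<longlonglongrightarrow> norm (cd t n - picard p \<omega> c k t n)"
      using LIMSEQ_ignore_initial_segment[OF lim[OF that, of n], of k]
      by (intro tendsto_intros) (simp add: add.commute)
  qed (use diff[OF that] in auto)
  have cd_le: "norm (cd t n) \<le> weight t n * \<mu> n" if "t \<in> {0..T}" for t n
    using cd_diff[OF that, of n 0] norm_picard_le[OF that, of 0 n]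
      norm_triangle_sub[of "cd t n" "picard p \<omega> c 0 t n"] by (simp add: right_diff_distrib)
  have cont: "continuous_on {0..T} (\<lambda>t. cd t n)" for n
  proof (rule uniform_limit_theorem)
    show "uniform_limit {0..T} (\<lambda>k t. picard p \<omega> c k t n) (\<lambda>t. cd t n) sequentially"
    proof (rule uniform_limitI)
      fix e :: real assume "e > 0"
      from order_tendstoD(2)[OF gap this]
      show "\<forall>\<^sub>F k in sequentially. \<forall>t\<in>{0..T}. dist (picard p \<omega> c k t n) (cd t n) < e"
      proof (rule eventually_mono, intro ballI)
        fix k t assume *: "\<mu> n - majorant k n < e" and t: "t \<in> {0..T}"
        have "norm (cd t n - picard p \<omega> c k t n) \<le> \<mu> n - majorant k n"
          using cd_diff[OF t, of n k] \<mu>(2)[of k n]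
            mult_right_mono[OF weight_le_1[OF t, of n], of "\<mu> n - majorant k n"] by simp
        with * show "dist (picard p \<omega> c k t n) (cd t n) < e" by (simp add: dist_norm norm_minus_commute)
      qed
    qed
  qed (auto simp: continuous_picard)
  have fix_pt: "cd t n = duhamel p \<omega> c cd t n" if "t \<in> {0..T}" for t n
  proof -
    \<comment> \<open>The bound of \<open>duhamel_diff_le\<close> for the limit against the
      \<open>k\<close>-th iterate; it tends to zero by monotone convergence of the convolution
      powers.\<close>
    define g where "g k = weight t n * (norm \<omega> / (real p * L) * (conv_power p \<mu> n - conv_power p (majorant k) n))" for k
    have "(\<lambda>k. conv_power p \<mu> n - conv_power p (majorant k) n) \<longlonglongrightarrow> 0"
      using tendsto_diff[OF tendsto_const conv_power_tendsto_mono[OF majorant_nonneg majorant_mono \<mu>(1,4)],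
          of "conv_power p \<mu> n" p n] by simp
    then have g: "g \<longlonglongrightarrow> 0"
      unfolding g_def by (intro tendsto_mult_right_zero)
    have "norm (duhamel p \<omega> c cd t n - picard p \<omega> c (Suc k) t n) \<le> g k" for k
      unfolding picard.simps g_def
      using cd_diff norm_picard_le
      by (intro duhamel_diff_le[OF p_pos L_pos LT that majorant_nonneg \<mu>(2,4) cont continuous_picard])
    then have "(\<lambda>k. duhamel p \<omega> c cd t n - picard p \<omega> c (Suc k) t n) \<longlonglongrightarrow> 0"
      by (intro Lim_null_comparison[OF _ g] always_eventually allI)
    moreover have "(\<lambda>k. duhamel p \<omega> c cd t n - picard p \<omega> c (Suc k) t n) \<longlonglongrightarrow> duhamel p \<omega> c cd t n - cd t n"
      by (intro tendsto_diff tendsto_const LIMSEQ_Suc lim that)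
    ultimately show ?thesis using LIMSEQ_unique by fastforce
  qed
  show thesis
    by (rule that[of \<mu> cd]) (fact \<mu> cont cd_le fix_pt lim)+
qed

end

subsection \<open>Fourier series with exponentially decaying coefficients\<close>

text \<open>The exponent \<open>j\<close> is the order of the termwise derivative in
  \<open>x\<close>; \<open>j = 0\<close> is the series itself.\<close>

definition fourier :: "real^'n \<Rightarrow> nat \<Rightarrow> (int^'n \<Rightarrow> complex) \<Rightarrow> real \<Rightarrow> complex" where
  "fourier \<omega> j b x = (\<Sum>\<^sub>\<infinity>n. (\<i> * of_real (dotw n \<omega>)) ^ j * b n * exp (\<i> * of_real (dotw n \<omega> * x)))"

text \<open>A single term of the exponential series of \<open>\<rho> * x\<close> is at most its
  sum.\<close>

lemma power_mult_exp_le: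
  fixes \<rho> x :: real
  assumes "0 < \<rho>" "0 \<le> x"
  shows "x ^ j * exp (- \<rho> * x) \<le> fact j / \<rho> ^ j"
proof -
  have "(\<Sum>n\<in>{j}. (\<rho> * x) ^ n /\<^sub>R fact n) \<le> exp (\<rho> * x)"
    unfolding exp_def using assms
    by (intro sum_le_suminf summable_exp_generic) (auto intro!: mult_nonneg_nonneg)
  then show ?thesis
    using assms by (simp add: exp_minus field_simps power_mult_distrib)
qed

text \<open>Exponential decay pays for any number \<open>j\<close> of derivatives, and the summable
  factor \<open>\<mu>\<close> remains for convergence uniform in \<open>x\<close>.\<close>

lemma fourier_term_le:
  assumes "0 < \<rho>" and b: "norm (b n) \<le> exp (- \<rho> * l1norm n) * \<mu> n" and "0 \<le> \<mu> n"
  shows "norm ((\<i> * of_real (dotw n \<omega>)) ^ j * b n * exp (\<i> * of_real (dotw n \<omega> * x)))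
     \<le> norm \<omega> ^ j * (fact j / \<rho> ^ j) * \<mu> n"
proof -
  have "norm ((\<i> * of_real (dotw n \<omega>)) ^ j * b n * exp (\<i> * of_real (dotw n \<omega> * x)))
      = \<bar>dotw n \<omega>\<bar> ^ j * norm (b n)"
    by (simp add: norm_mult norm_power)
  also have "\<dots> \<le> (norm \<omega> * l1norm n) ^ j * (exp (- \<rho> * l1norm n) * \<mu> n)"
    by (intro mult_mono power_mono abs_dotw_le b) (auto simp: l1norm_nonneg)
  also have "\<dots> = norm \<omega> ^ j * (l1norm n ^ j * exp (- \<rho> * l1norm n)) * \<mu> n"
    by (simp add: power_mult_distrib)
  also have "\<dots> \<le> norm \<omega> ^ j * (fact j / \<rho> ^ j) * \<mu> n"
    by (intro mult_right_mono mult_left_mono power_mult_exp_le assms l1norm_nonneg) auto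
  finally show ?thesis .
qed

lemma infinite_UNIV_int_vec: "infinite (UNIV :: (int^'n) set)"
proof
  assume "finite (UNIV :: (int^'n) set)"
  then have "finite (range (\<lambda>k::int. \<chi> i::'n. k))" by (rule finite_subset[rotated]) auto
  moreover have "inj (\<lambda>k::int. \<chi> i::'n. k)" by (auto simp: inj_on_def vec_eq_iff)
  ultimately show False using finite_imageD infinite_UNIV_int by blast
qed

text \<open>The rate \<open>\<rho>\<close> pays for derivatives and \<open>\<mu>\<close> for
  summation. Convolution keeps the rate and replaces only the summable factor, so the locale also
  applies to the nonlinear term.\<close>

locale exp_decay =
  fixes \<rho> :: real and \<mu> :: "int^'n \<Rightarrow> real"
  assumes \<rho>_pos: "0 < \<rho>" and \<mu>_nonneg: "\<And>n. 0 \<le> \<mu> n" and \<mu>_summable: "\<mu> summable_on UNIV"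
begin

lemma symbol_mult_le:
  assumes "norm (b n) \<le> exp (- \<rho> * l1norm n) * \<mu> n"
  shows "norm ((\<i> * of_real (dotw n \<omega>)) ^ j * b n) \<le> norm \<omega> ^ j * (fact j / \<rho> ^ j) * \<mu> n"
  using fourier_term_le[of \<rho> b n \<mu> \<omega> j 0, OF \<rho>_pos assms \<mu>_nonneg] by simp

lemma fourier_term_summable:
  assumes "\<And>n. norm (b n) \<le> exp (- \<rho> * l1norm n) * \<mu> n"
  shows "(\<lambda>n. norm ((\<i> * of_real (dotw n \<omega>)) ^ j * b n * exp (\<i> * of_real (dotw n \<omega> * x)))) summable_on UNIV"
  by (rule summable_on_comparison_test[OF summable_on_cmult_right[OF \<mu>_summable, of "norm \<omega> ^ j * (fact j / \<rho> ^ j)"]])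
     (rule fourier_term_le[OF \<rho>_pos assms \<mu>_nonneg] norm_ge_zero)+

lemma fourier_has_vector_derivative:
  assumes "\<And>n. norm (b n) \<le> exp (- \<rho> * l1norm n) * \<mu> n"
  shows "(fourier \<omega> j b has_vector_derivative fourier \<omega> (Suc j) b x) (at x)"
  unfolding fourier_def[abs_def]
proof (rule has_vector_derivative_infsum[OF infinite_UNIV_int_vec convex_UNIV, simplified])
  fix n x
  show "((\<lambda>x. (\<i> * of_real (dotw n \<omega>)) ^ j * b n * exp (\<i> * of_real (dotw n \<omega> * x)))
      has_vector_derivative (\<i> * of_real (dotw n \<omega>)) ^ Suc j * b n * exp (\<i> * of_real (dotw n \<omega> * x))) (at x)"
    using has_vector_derivative_mult_right[OF exp_ii_has_vector_derivative,
        of "(\<i> * of_real (dotw n \<omega>)) ^ j * b n" "dotw n \<omega>" x UNIV] by (simp add: mult_ac)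
qed (rule fourier_term_le[OF \<rho>_pos assms \<mu>_nonneg] summable_on_cmult_right[OF \<mu>_summable])+

lemma fourier_has_time_derivative:
  assumes "t \<in> {0..T}"
    and der: "\<And>t n. t \<in> {0..T} \<Longrightarrow> ((\<lambda>t. b t n) has_vector_derivative b' t n) (at t within {0..T})"
    and b: "\<And>t n. t \<in> {0..T} \<Longrightarrow> norm (b t n) \<le> exp (- \<rho> * l1norm n) * \<mu> n"
    and b': "\<And>t n. t \<in> {0..T} \<Longrightarrow> norm (b' t n) \<le> \<mu>' n" and "\<mu>' summable_on UNIV"
  shows "((\<lambda>t. fourier \<omega> 0 (b t) x) has_vector_derivative fourier \<omega> 0 (b' t) x) (at t within {0..T})"
  unfolding fourier_def
proof (rule has_vector_derivative_infsum[OF infinite_UNIV_int_vec])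
  fix n s assume "s \<in> {0..T}"
  show "((\<lambda>t. (\<i> * of_real (dotw n \<omega>)) ^ 0 * b t n * exp (\<i> * of_real (dotw n \<omega> * x)))
    has_vector_derivative (\<i> * of_real (dotw n \<omega>)) ^ 0 * b' s n * exp (\<i> * of_real (dotw n \<omega> * x))) (at s within {0..T})"
    using der[OF \<open>s \<in> {0..T}\<close>, of n] by (auto intro!: has_vector_derivative_mult_left)
  show "norm ((\<i> * of_real (dotw n \<omega>)) ^ 0 * b' s n * exp (\<i> * of_real (dotw n \<omega> * x))) \<le> \<mu>' n"
    using b'[OF \<open>s \<in> {0..T}\<close>, of n] by (simp add: norm_mult)
  show "norm ((\<i> * of_real (dotw n \<omega>)) ^ 0 * b s n * exp (\<i> * of_real (dotw n \<omega> * x)))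
      \<le> norm \<omega> ^ 0 * (fact 0 / \<rho> ^ 0) * \<mu> n"
    by (rule fourier_term_le[OF \<rho>_pos b[OF \<open>s \<in> {0..T}\<close>] \<mu>_nonneg])
qed (rule convex_real_interval summable_on_cmult_right[OF \<mu>_summable] assms)+

lemma continuous_on_fourier:
  fixes b :: "real \<Rightarrow> int^'n \<Rightarrow> complex"
  assumes "\<And>n. continuous_on S (\<lambda>t. b t n)"
    and "\<And>t n. t \<in> S \<Longrightarrow> norm (b t n) \<le> exp (- \<rho> * l1norm n) * \<mu> n"
  shows "continuous_on (S \<times> UNIV) (\<lambda>(t, x). fourier \<omega> j (b t) x)"
  unfolding fourier_def case_prod_unfold
proof (rule continuous_on_infsum)
  fix n
  have "continuous_on (S \<times> UNIV) (\<lambda>y :: real \<times> real. b (fst y) n)"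
    by (rule continuous_on_compose2[OF assms(1)]) (auto intro!: continuous_intros)
  then show "continuous_on (S \<times> UNIV) (\<lambda>y. (\<i> * of_real (dotw n \<omega>)) ^ j * b (fst y) n *
      exp (\<i> * of_real (dotw n \<omega> * snd y)))"
    by (intro continuous_intros)
next
  fix n and y :: "real \<times> real" assume "y \<in> S \<times> UNIV"
  then show "norm ((\<i> * of_real (dotw n \<omega>)) ^ j * b (fst y) n * exp (\<i> * of_real (dotw n \<omega> * snd y)))
      \<le> norm \<omega> ^ j * (fact j / \<rho> ^ j) * \<mu> n"
    by (intro fourier_term_le[OF \<rho>_pos assms(2) \<mu>_nonneg]) auto
qed (rule summable_on_cmult_right[OF \<mu>_summable])

lemma norm_le_majorant:
  assumes "norm (b n) \<le> exp (- \<rho> * l1norm n) * \<mu> n"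
  shows "norm (b n) \<le> \<mu> n"
proof -
  have "exp (- \<rho> * l1norm n) \<le> 1" using \<rho>_pos l1norm_nonneg[of n] by simp
  from mult_right_mono[OF this \<mu>_nonneg[of n]] assms show ?thesis by simp
qed

text \<open>Along a tuple summing to \<open>n\<close> the phases multiply to the phase of
  \<open>n\<close>. Absorbing them into the coefficients reduces the claim to multiplicativity of
  total sums.\<close>

lemma fourier_conv_power:
  assumes b: "\<And>n. norm (b n) \<le> exp (- \<rho> * l1norm n) * \<mu> n"
  shows "fourier \<omega> 0 (conv_power p b) x = fourier \<omega> 0 b x ^ p"
proof -
  define a where "a n = b n * exp (\<i> * of_real (dotw n \<omega> * x))" for n
  have "(\<lambda>n. norm (a n)) summable_on UNIV"
    using fourier_term_summable[OF b, where j = 0] by (simp add: a_def)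
  from infsum_conv_power[OF this, of p]
  have "(\<Sum>\<^sub>\<infinity>n. conv_power p a n) = fourier \<omega> 0 b x ^ p" by (simp add: fourier_def a_def[abs_def])
  moreover have "conv_power p a n = conv_power p b n * exp (\<i> * of_real (dotw n \<omega> * x))" for n
  proof -
    have "(\<Prod>j<p. a (f j)) = (\<Prod>j<p. b (f j)) * exp (\<i> * of_real (dotw n \<omega> * x))" if "f \<in> tuples p n" for f
    proof -
      have "dotw n \<omega> = (\<Sum>j<p. dotw (f j) \<omega>)"
        using that dotw_sum[of "{..<p}" f \<omega>] unfolding tuples_def by simp
      then show ?thesis
        by (simp add: a_def prod.distrib exp_sum[symmetric] sum_distrib_left sum_distrib_right)
    qed
    then have "conv_power p a n = (\<Sum>\<^sub>\<infinity>f\<in>tuples p n. (\<Prod>j<p. b (f j)) * exp (\<i> * of_real (dotw n \<omega> * x)))"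
      unfolding conv_power_def by (rule infsum_cong)
    then show ?thesis by (simp add: conv_power_def infsum_cmult_left')
  qed
  ultimately show ?thesis by (simp add: fourier_def)
qed

text \<open>Differentiating the Duhamel equation for each coefficient and summing the Fourier series
  gives the equation in the form where the nonlinearity is the \<open>x\<close>-derivative of
  \<open>u ^ p\<close> divided by \<open>p\<close>; the chain rule brings it to the stated
  form.\<close>

theorem gkdv_solution:
  assumes p: "0 < p"
    and cont: "\<And>n. continuous_on {0..T} (\<lambda>t. a t n)"
    and a: "\<And>t n. t \<in> {0..T} \<Longrightarrow> norm (a t n) \<le> exp (- \<rho> * l1norm n) * \<mu> n"
    and duhamel: "\<And>t n. t \<in> {0..T} \<Longrightarrow> a t n = duhamel p \<omega> c a t n"
  shows "gkdv_classical_solution p T (\<lambda>t. fourier \<omega> 0 (a t))"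
proof -
  have \<mu>': "(\<lambda>n. norm (\<mu> n)) summable_on UNIV" using \<mu>_nonneg \<mu>_summable by simp
  interpret conv: exp_decay \<rho> "conv_power p \<mu>"
    by unfold_locales (auto intro: \<rho>_pos conv_power_nonneg \<mu>_nonneg summable_conv_power[OF \<mu>'])
  define C where "C t = conv_power p (a t)" for t
  have C: "norm (C t n) \<le> exp (- \<rho> * l1norm n) * conv_power p \<mu> n" if "t \<in> {0..T}" for t n
    unfolding C_def using \<rho>_pos by (intro norm_conv_power_le \<mu>_summable p a that) auto
  have contC: "continuous_on {0..T} (\<lambda>t. C t n)" for n
    unfolding C_def by (rule continuous_on_conv_power[OF cont _ \<mu>_summable \<mu>_nonneg]) (rule norm_le_majorant[OF a])
  \<comment> \<open>Because of this sign the linear phase contributes minus the third space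
    derivative.\<close>
  have ii3: "(\<i> * z) ^ 3 = - (\<i> * z ^ 3)" for z :: complex
    by (simp add: power_mult_distrib) (simp add: power3_eq_cube)
  define a' where "a' t n = - ((\<i> * of_real (dotw n \<omega>)) ^ 3 * a t n
      + (\<i> * of_real (dotw n \<omega>)) ^ 1 * C t n / of_nat p)" for t n
  have der: "((\<lambda>t. a t n) has_vector_derivative a' t n) (at t within {0..T})" if "t \<in> {0..T}" for t n
  proof -
    have "((\<lambda>t. duhamel p \<omega> c a t n) has_vector_derivative
      (\<i> * of_real ((dotw n \<omega>)^3) * duhamel p \<omega> c a t n
       - (\<i> * of_real (dotw n \<omega>) / of_nat p) * conv p (a t) n)) (at t within {0..T})"
      by (rule duhamel_has_vector_derivative[OF _ that])
        (use contC in \<open>simp add: conv_eq_conv_power C_def\<close>)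
    also have "\<i> * of_real ((dotw n \<omega>)^3) * duhamel p \<omega> c a t n
       - (\<i> * of_real (dotw n \<omega>) / of_nat p) * conv p (a t) n = a' t n"
      unfolding duhamel[OF that, symmetric]
      by (simp add: a'_def C_def conv_eq_conv_power ii3)
    finally show ?thesis
      by (rule has_vector_derivative_transform[OF that, rotated]) (simp add: duhamel)
  qed
  let ?K = "\<lambda>j n. norm \<omega> ^ j * (fact j / \<rho> ^ j) * \<mu> n"
  let ?K' = "\<lambda>j n. norm \<omega> ^ j * (fact j / \<rho> ^ j) * conv_power p \<mu> n"
  have a'_le: "norm (a' t n) \<le> ?K 3 n + ?K' 1 n" if "t \<in> {0..T}" for t n
  proof -
    have "norm (a' t n) \<le> norm ((\<i> * of_real (dotw n \<omega>)) ^ 3 * a t n)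
      + norm ((\<i> * of_real (dotw n \<omega>)) ^ 1 * C t n / of_nat p)"
      unfolding a'_def norm_minus_cancel by (rule norm_triangle_ineq)
    also have "norm ((\<i> * of_real (dotw n \<omega>)) ^ 1 * C t n / of_nat p) \<le> norm ((\<i> * of_real (dotw n \<omega>)) ^ 1 * C t n)"
      using p by (simp add: norm_divide divide_le_eq mult_le_cancel_left1)
    also have "norm ((\<i> * of_real (dotw n \<omega>)) ^ 3 * a t n) \<le> ?K 3 n"
      by (rule symbol_mult_le[OF a[OF that]])
    also have "norm ((\<i> * of_real (dotw n \<omega>)) ^ 1 * C t n) \<le> ?K' 1 n"
      by (rule conv.symbol_mult_le[OF C[OF that]])
    finally show ?thesis by simp
  qed
  have ut_eq: "fourier \<omega> 0 (a' t) x = - (fourier \<omega> 3 (a t) x + fourier \<omega> 1 (C t) x / of_nat p)"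
    if "t \<in> {0..T}" for t x
  proof -
    have "((\<lambda>n. (\<i> * of_real (dotw n \<omega>)) ^ 3 * a t n * exp (\<i> * of_real (dotw n \<omega> * x))) has_sum fourier \<omega> 3 (a t) x) UNIV"
      unfolding fourier_def
      by (rule has_sum_infsum, rule abs_summable_summable, rule fourier_term_summable[OF a[OF that]])
    moreover have "((\<lambda>n. (\<i> * of_real (dotw n \<omega>)) ^ 1 * C t n * exp (\<i> * of_real (dotw n \<omega> * x))) has_sum fourier \<omega> 1 (C t) x) UNIV"
      unfolding fourier_def
      by (rule has_sum_infsum, rule abs_summable_summable, rule conv.fourier_term_summable[OF C[OF that]])
    ultimately have "((\<lambda>n. - ((\<i> * of_real (dotw n \<omega>)) ^ 3 * a t n * exp (\<i> * of_real (dotw n \<omega> * x))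
        + (\<i> * of_real (dotw n \<omega>)) ^ 1 * C t n * exp (\<i> * of_real (dotw n \<omega> * x)) * (1 / of_nat p)))
        has_sum - (fourier \<omega> 3 (a t) x + fourier \<omega> 1 (C t) x * (1 / of_nat p))) UNIV"
      unfolding has_sum_uminus minus_minus by (intro has_sum_add has_sum_cmult_left)
    from infsumI[OF this] show ?thesis
      unfolding fourier_def[of \<omega> 0] by (simp add: a'_def algebra_simps)
  qed
  \<comment> \<open>The series with coefficients \<open>C t\<close> is differentiated twice over:
    termwise, and by the chain rule as the \<open>p\<close>-th power of the solution. Derivatives
    being unique, the results agree.\<close>
  have nonlinear: "fourier \<omega> 1 (C t) x = of_nat p * (fourier \<omega> 0 (a t) x ^ (p - 1) * fourier \<omega> 1 (a t) x)"
    if "t \<in> {0..T}" for t x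
  proof -
    have "((\<lambda>y. fourier \<omega> 0 (a t) y) has_vector_derivative fourier \<omega> 1 (a t) x) (at x)"
      using fourier_has_vector_derivative[OF a[OF that], of \<omega> 0 x] by simp
    moreover have "((\<lambda>z. z ^ p) has_field_derivative of_nat p * fourier \<omega> 0 (a t) x ^ (p - 1)) (at (fourier \<omega> 0 (a t) x))"
      by (auto intro!: derivative_eq_intros)
    ultimately have "((\<lambda>z. z ^ p) \<circ> fourier \<omega> 0 (a t) has_vector_derivative
        fourier \<omega> 1 (a t) x * (of_nat p * fourier \<omega> 0 (a t) x ^ (p - 1))) (at x)"
      by (rule field_vector_diff_chain_at)
    moreover have "(\<lambda>z. z ^ p) \<circ> fourier \<omega> 0 (a t) = fourier \<omega> 0 (C t)"
      by (simp add: fun_eq_iff C_def fourier_conv_power[OF a[OF that]])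
    moreover have "(fourier \<omega> 0 (C t) has_vector_derivative fourier \<omega> 1 (C t) x) (at x)"
      using conv.fourier_has_vector_derivative[OF C[OF that], of \<omega> 0 x] by simp
    ultimately show ?thesis
      using vector_derivative_unique_at by (fastforce simp: mult_ac)
  qed
  have sub: "{0..<T} \<subseteq> {0..T}" by auto
  have cont_a: "continuous_on ({0..<T} \<times> UNIV) (\<lambda>(t, x). fourier \<omega> j (a t) x)" for j
    by (rule continuous_on_fourier) (use a in \<open>auto intro: continuous_on_subset[OF cont sub]\<close>)
  have cont_C: "continuous_on ({0..<T} \<times> UNIV) (\<lambda>(t, x). fourier \<omega> 1 (C t) x)"
    by (rule conv.continuous_on_fourier) (use C in \<open>auto intro: continuous_on_subset[OF contC sub]\<close>)
  show ?thesis
    unfolding gkdv_classical_solution_def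
  proof (intro exI conjI ballI allI)
    fix t x assume "t \<in> {0..<T}"
    then have t: "t \<in> {0..T}" by simp
    \<comment> \<open>Obtained on the closed interval, where the coefficient bounds hold, and then
      restricted to the half-open one.\<close>
    have "((\<lambda>t. fourier \<omega> 0 (a t) x) has_vector_derivative fourier \<omega> 0 (a' t) x) (at t within {0..T})"
      by (rule fourier_has_time_derivative[OF t der a a'_le])
        (assumption | intro summable_on_add summable_on_cmult_right \<mu>_summable conv.\<mu>_summable)+
    then show "((\<lambda>t. fourier \<omega> 0 (a t) x) has_vector_derivative
        - (fourier \<omega> 3 (a t) x + fourier \<omega> 1 (C t) x / of_nat p)) (at t within {0..<T})"
      unfolding ut_eq[OF t] using sub by (rule has_vector_derivative_within_subset)
    show "(fourier \<omega> 0 (a t) has_vector_derivative fourier \<omega> 1 (a t) x) (at x)"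
      "(fourier \<omega> 1 (a t) has_vector_derivative fourier \<omega> 2 (a t) x) (at x)"
      "(fourier \<omega> 2 (a t) has_vector_derivative fourier \<omega> 3 (a t) x) (at x)"
      using fourier_has_vector_derivative[OF a[OF t], of \<omega> _ x] by (metis One_nat_def numeral_2_eq_2 numeral_3_eq_3)+
    show "- (fourier \<omega> 3 (a t) x + fourier \<omega> 1 (C t) x / of_nat p) + fourier \<omega> 3 (a t) x
      + fourier \<omega> 0 (a t) x ^ (p - 1) * fourier \<omega> 1 (a t) x = 0"
      using p unfolding nonlinear[OF t] by simp
  next
    show "continuous_on ({0..<T} \<times> UNIV) (\<lambda>(t, x). - (fourier \<omega> 3 (a t) x + fourier \<omega> 1 (C t) x / of_nat p))"
      using cont_a[of 3] cont_C p unfolding case_prod_unfold by (intro continuous_intros) auto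
  qed (rule cont_a)+
qed

end

subsection \<open>The choice of constants\<close>

text \<open>The all-ones frequency is nonzero, hence not orthogonal to \<open>\<omega>\<close>. A
  positive norm makes \<open>t0\<close> and the rate \<open>L\<close> positive.\<close>

lemma norm_pos_of_indep:
  fixes \<omega> :: "real^'n"
  assumes "\<forall>n::int^'n. dotw n \<omega> = 0 \<longrightarrow> n = 0"
  shows "0 < norm \<omega>"
proof -
  have "dotw (1::int^'n) \<omega> \<noteq> 0" using assms by force
  then show ?thesis by (auto simp: dotw_def)
qed

text \<open>Lowering the rate \<open>\<kappa> / 2\<close> by \<open>\<delta>\<close> multiplies the
  mass bound by the inverse of \<open>(1 - x) ^ N\<close>, which Bernoulli's inequality keeps below
  \<open>3 / 2\<close>. Since \<open>Box\<close> contains a factor 2, this leaves a quarter of it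
  for the nonlinear term.\<close>

lemma decay_mass_le:
  fixes \<kappa> \<delta> :: real
  assumes "0 < \<kappa>" "\<kappa> \<le> 1" "0 \<le> \<delta>" "\<delta> \<le> \<kappa> / 12 ^ (N + 1)"
  shows "0 < \<kappa> / 2 - \<delta>" "(3 / (\<kappa> / 2 - \<delta>)) ^ N \<le> 3 / 2 * (6 / \<kappa>) ^ N"
proof -
  define x where "x = 2 * \<delta> / \<kappa>"
  have N12: "real N \<le> 12 ^ N" using of_nat_less_two_power[of N, where 'a = real] power_mono[of 2 "12::real" N] by simp
  have x: "0 \<le> x" "x \<le> 2 / 12 ^ (N + 1)"
    using assms by (auto simp: x_def field_simps)
  have "2 / 12 ^ (N + 1) \<le> (1 / 6 :: real)" by (simp add: field_simps)
  then have x1: "x \<le> 1 / 6" using x by linarith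
  have eq: "\<kappa> / 2 - \<delta> = \<kappa> / 2 * (1 - x)" using assms by (simp add: x_def field_simps)
  then show "0 < \<kappa> / 2 - \<delta>" using assms(1) x1 by (simp only: zero_less_mult_iff) simp
  have "real N * x \<le> 12 ^ N * (2 / 12 ^ (N + 1))"
    using N12 x by (intro mult_mono) auto
  then have "real N * x \<le> 1 / 6" by simp
  then have "2 / 3 \<le> 1 + real N * (- x)" by simp
  also have "\<dots> \<le> (1 + (- x)) ^ N"
    by (rule Bernoulli_inequality) (use x1 in simp)
  finally have B: "2 / 3 \<le> (1 - x) ^ N" by simp
  have "(3 / (\<kappa> / 2 - \<delta>)) ^ N = (6 / \<kappa>) ^ N / (1 - x) ^ N"
    using assms x1 unfolding eq power_divide[symmetric] by (simp add: field_simps)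
  also have "\<dots> \<le> (6 / \<kappa>) ^ N / (2 / 3)"
    using B assms by (intro divide_left_mono) auto
  finally show "(3 / (\<kappa> / 2 - \<delta>)) ^ N \<le> 3 / 2 * (6 / \<kappa>) ^ N" by simp
qed

section \<open>Verification of the mass budget and assembly of the solution\<close>

theorem theorem1:
  fixes p :: nat and \<omega> :: "real^'n" and c :: "int^'n \<Rightarrow> complex"
    and A \<kappa> :: real
  assumes hp: "p \<ge> 2"
    and indep: "\<forall>n::int^'n. dotw n \<omega> = 0 \<longrightarrow> n = 0"
    and hA: "A > 0" and h\<kappa>0: "0 < \<kappa>" and h\<kappa>1: "\<kappa> \<le> 1"
    and hc: "\<forall>n. norm (c n) \<le> A powr (1 / (real p - 1)) * exp (- \<kappa> * l1norm n)"
  defines "u0 \<equiv> (\<lambda>x::real. \<Sum>\<^sub>\<infinity>n\<in>UNIV. c n * exp (\<i> * of_real (dotw n \<omega> * x)))"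
    and "Box \<equiv> 2 * (6 / \<kappa>) ^ CARD('n) * A powr (1 / (real p - 1))"
    and "t0 \<equiv> min
       (\<kappa> ^ ((p - 1) * CARD('n) + 1)
          / (2 ^ (p + 1) * 6 ^ ((p - 1) * CARD('n) + 1) * A * norm \<omega>))
       (\<kappa> ^ ((p - 1) * CARD('n) + 1)
          / (2 * (real p - 1) * exp 1 * (2 * (6 / \<kappa>) ^ CARD('n) * A powr (1 / (real p - 1))) ^ (p - 1) * 12 ^ ((p - 1) * CARD('n) + 1) * norm \<omega>))"
  shows "t0 > 0 \<and>
    (\<exists>cd :: real \<Rightarrow> int^'n \<Rightarrow> complex.
       (\<forall>t\<in>{0..<t0}. \<forall>n. norm (cd t n) \<le> Box * exp (- (\<kappa> / 2) * l1norm n))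
     \<and> (\<forall>t\<in>{0..<t0}. \<forall>n.
          (\<forall>\<tau>\<in>{0..t}. conv_summand p (cd \<tau>) summable_on tuples p n)
        \<and> duhamel_integrand p \<omega> cd t n integrable_on {0..t}
        \<and> cd t n = duhamel p \<omega> c cd t n)
     \<and> (\<forall>t\<in>{0..<t0}. \<forall>x::real. (\<lambda>n. cd t n * exp (\<i> * of_real (dotw n \<omega> * x))) summable_on UNIV)
     \<and> gkdv_classical_solution p t0
         (\<lambda>t x. \<Sum>\<^sub>\<infinity>n\<in>UNIV. cd t n * exp (\<i> * of_real (dotw n \<omega> * x)))
     \<and> (\<forall>x. (\<Sum>\<^sub>\<infinity>n\<in>UNIV. cd 0 n * exp (\<i> * of_real (dotw n \<omega> * x))) = u0 x)
     \<and> (\<forall>t\<in>{0..<t0}. \<forall>n. (\<lambda>k. picard p \<omega> c k t n) \<longlonglongrightarrow> cd t n))"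
proof -
  define N where "N = CARD('n)"
  define B where "B = A powr (1 / (real p - 1))"
  define M where "M = (p - 1) * N + 1"
  \<comment> \<open>This choice makes \<open>norm \<omega> / (real p * L) * Box ^ p\<close> equal to
    \<open>Box / (2 * real p)\<close>, at most the free quarter of \<open>Box\<close> as
    \<open>p\<close> is at least 2.\<close>
  define L where "L = 2 * norm \<omega> * Box ^ (p - 1)"
  have \<omega>: "0 < norm \<omega>" by (rule norm_pos_of_indep[OF indep])
  have B: "0 < B" using hA by (simp add: B_def)
  have Box: "Box = 2 * (6 / \<kappa>) ^ N * B" by (simp add: Box_def N_def B_def)
  have Box_pos: "0 < Box" using B h\<kappa>0 by (simp add: Box)
  have p0: "0 < p" and p1: "1 \<le> real p - 1" using hp by auto
  have L: "0 < L" using \<omega> Box_pos by (simp add: L_def)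
  have "t0 = min (\<kappa> ^ M / (2 ^ (p + 1) * 6 ^ M * A * norm \<omega>))
      (\<kappa> ^ M / (2 * (real p - 1) * exp 1 * Box ^ (p - 1) * 12 ^ M * norm \<omega>))"
    unfolding t0_def M_def N_def Box_def ..
  then have t0_le: "t0 \<le> \<kappa> ^ M / (2 * (real p - 1) * exp 1 * Box ^ (p - 1) * 12 ^ M * norm \<omega>)"
    and t0_pos: "0 < t0"
    using h\<kappa>0 \<omega> hA Box_pos p1 by auto
  \<comment> \<open>With the second term of the minimum inserted, \<open>Box ^ (p - 1)\<close> and
    \<open>norm \<omega>\<close> cancel against \<open>L\<close>.\<close>
  have "L * t0 \<le> L * (\<kappa> ^ M / (2 * (real p - 1) * exp 1 * Box ^ (p - 1) * 12 ^ M * norm \<omega>))"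
    using L t0_le by (intro mult_left_mono) auto
  also have "\<dots> = \<kappa> ^ M / ((real p - 1) * exp 1 * 12 ^ M)"
    using Box_pos \<omega> p1 by (simp add: L_def field_simps)
  also have "\<dots> \<le> \<kappa> / 12 ^ (N + 1)"
  proof (rule frac_le)
    show "\<kappa> ^ M \<le> \<kappa>" using power_decreasing[of 1 M \<kappa>] h\<kappa>0 h\<kappa>1 by (simp add: M_def)
    have "1 * N \<le> (p - 1) * N" using hp by (intro mult_le_mono1) simp
    then have "N + 1 \<le> M" unfolding M_def by linarith
    then have "12 ^ (N + 1) \<le> (12 :: real) ^ M" by (intro power_increasing) auto
    also have "\<dots> \<le> ((real p - 1) * exp 1) * 12 ^ M"
    proof -
      have "1 * 1 \<le> (real p - 1) * exp 1" using p1 by (intro mult_mono) auto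
      from mult_right_mono[OF this, of "12 ^ M"] show ?thesis by simp
    qed
    finally show "12 ^ (N + 1) \<le> (real p - 1) * exp 1 * 12 ^ M" .
  qed (use h\<kappa>0 in auto)
  finally have \<delta>: "L * t0 \<le> \<kappa> / 12 ^ (N + 1)" .
  have Lt0: "0 \<le> L * t0" using L t0_pos by simp
  note budget0 = decay_mass_le[OF h\<kappa>0 h\<kappa>1 Lt0 \<delta>]
  \<comment> \<open>The rates \<open>\<sigma>\<close> and \<open>s\<close> add up to
    \<open>\<kappa>\<close>, so the decay of \<open>c\<close> splits between initial weight and
    initial majorant. The weight rate \<open>\<sigma> - L * t\<close> then falls to exactly
    \<open>\<kappa> / 2\<close> at \<open>t0\<close>.\<close>
  define \<sigma> where "\<sigma> = \<kappa> / 2 + L * t0"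
  define s where "s = \<kappa> / 2 - L * t0"
  have s: "0 < s" "s \<le> 1" "(3 / s) ^ N \<le> 3 / 2 * (6 / \<kappa>) ^ N"
    using budget0 Lt0 h\<kappa>1 unfolding s_def by (blast, linarith, blast)
  interpret majorized_picard p \<omega> c \<sigma> L t0 Box "\<lambda>n. B * exp (- s * l1norm n)"
  proof
    show "norm (c n) \<le> exp (- \<sigma> * l1norm n) * (B * exp (- s * l1norm n))" for n
    proof -
      have "exp (- \<sigma> * l1norm n) * (B * exp (- s * l1norm n)) = B * exp (- \<kappa> * l1norm n)"
        by (simp add: mult_exp_exp \<sigma>_def s_def algebra_simps)
      then show ?thesis using hc unfolding B_def by (simp only:)
    qed
    show "(\<lambda>n::int^'n. B * exp (- s * l1norm n)) summable_on UNIV"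
      by (intro summable_on_cmult_right infsum_exp_l1norm s)
    have "(\<Sum>\<^sub>\<infinity>n::int^'n. B * exp (- s * l1norm n)) = B * (\<Sum>\<^sub>\<infinity>n::int^'n. exp (- s * l1norm n))"
      by (rule infsum_cmult_right')
    also have "\<dots> \<le> B * (3 / 2 * (6 / \<kappa>) ^ N)"
      using infsum_exp_l1norm(2)[OF s(1,2), where 'n = 'n] s(3) B by (intro mult_left_mono) (auto simp: N_def)
    also have "\<dots> = 3 / 4 * Box" by (simp add: Box)
    finally have 1: "(\<Sum>\<^sub>\<infinity>n::int^'n. B * exp (- s * l1norm n)) \<le> 3 / 4 * Box" .
    have "Box ^ p = Box * Box ^ (p - 1)" using p0 by (simp add: power_eq_if)
    then have "norm \<omega> / (real p * L) * Box ^ p = Box / (2 * real p)"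
      using \<omega> Box_pos p0 by (simp add: L_def)
    also have "\<dots> \<le> Box / 4"
      using hp Box_pos by (intro divide_left_mono) auto
    finally show "(\<Sum>\<^sub>\<infinity>n::int^'n. B * exp (- s * l1norm n)) + norm \<omega> / (real p * L) * Box ^ p \<le> Box"
      using 1 by linarith
  qed (use p0 L Box_pos h\<kappa>0 in \<open>auto simp: \<sigma>_def\<close>)
  obtain cd \<mu> where \<mu>: "\<mu> summable_on UNIV" "(\<Sum>\<^sub>\<infinity>n. \<mu> n) \<le> Box" "\<And>n. 0 \<le> \<mu> n"
    and cont: "\<And>n. continuous_on {0..t0} (\<lambda>t. cd t n)"
    and cd: "\<And>t n. t \<in> {0..t0} \<Longrightarrow> norm (cd t n) \<le> exp (- (\<sigma> - L * t) * l1norm n) * \<mu> n"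
    and fix_pt: "\<And>t n. t \<in> {0..t0} \<Longrightarrow> cd t n = duhamel p \<omega> c cd t n"
    and lim: "\<And>t n. t \<in> {0..t0} \<Longrightarrow> (\<lambda>k. picard p \<omega> c k t n) \<longlonglongrightarrow> cd t n"
    using picard_limit by metis
  interpret exp_decay "\<kappa> / 2" \<mu>
    by unfold_locales (use h\<kappa>0 \<mu> in auto)
  have decay: "norm (cd t n) \<le> exp (- (\<kappa> / 2) * l1norm n) * \<mu> n" if "t \<in> {0..t0}" for t n
  proof -
    have "L * t \<le> L * t0" using that L by (intro mult_left_mono) auto
    then have "- (\<sigma> - L * t) * l1norm n \<le> - (\<kappa> / 2) * l1norm n"
      by (intro mult_right_mono l1norm_nonneg) (simp add: \<sigma>_def)
    then have "exp (- (\<sigma> - L * t) * l1norm n) * \<mu> n \<le> exp (- (\<kappa> / 2) * l1norm n) * \<mu> n"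
      by (intro mult_right_mono \<mu>) simp
    with cd[OF that, of n] show ?thesis by (rule order_trans)
  qed
  have \<mu>_le: "\<mu> n \<le> Box" for n
    using finite_sum_le_infsum[OF \<mu>(1), of "{n}"] \<mu>(2,3) by (auto intro: order_trans)
  have abs_summable: "(\<lambda>n. norm (cd t n)) summable_on UNIV" if "t \<in> {0..t0}" for t
    by (rule summable_on_comparison_test[OF \<mu>(1)]) (auto intro: norm_le_majorant decay that)
  have conv_cont: "continuous_on {0..t0} (\<lambda>t. conv p (cd t) n)" for n
    unfolding conv_eq_conv_power
    by (rule continuous_on_conv_power[OF cont _ \<mu>(1,3)]) (rule norm_le_majorant[OF decay])
  have u: "(\<lambda>t x. \<Sum>\<^sub>\<infinity>n. cd t n * exp (\<i> * of_real (dotw n \<omega> * x))) = (\<lambda>t. fourier \<omega> 0 (cd t))"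
    by (simp add: fourier_def fun_eq_iff)
  show ?thesis
  proof (intro conjI t0_pos exI[of _ cd] ballI allI)
    fix t n assume "t \<in> {0..<t0}"
    then have t: "t \<in> {0..t0}" by simp
    have "exp (- (\<kappa> / 2) * l1norm n) * \<mu> n \<le> exp (- (\<kappa> / 2) * l1norm n) * Box"
      by (intro mult_left_mono \<mu>_le) simp
    with decay[OF t, of n] show "norm (cd t n) \<le> Box * exp (- (\<kappa> / 2) * l1norm n)"
      unfolding mult.commute[of Box] by (rule order_trans)
    show "conv_summand p (cd \<tau>) summable_on tuples p n" if "\<tau> \<in> {0..t}" for \<tau>
      unfolding conv_summand_def[abs_def] using that t by (intro tuples_summable abs_summable) auto
    show "duhamel_integrand p \<omega> cd t n integrable_on {0..t}"
      using t by (intro integrable_continuous_real continuous_on_duhamel_integrand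
          continuous_on_subset[OF conv_cont]) auto
    show "cd t n = duhamel p \<omega> c cd t n" by (rule fix_pt[OF t])
    show "(\<lambda>k. picard p \<omega> c k t n) \<longlonglongrightarrow> cd t n" by (rule lim[OF t])
  next
    fix t x assume "t \<in> {0..<t0}"
    then have t: "t \<in> {0..t0}" by simp
    show "(\<lambda>n. cd t n * exp (\<i> * of_real (dotw n \<omega> * x))) summable_on UNIV"
      using abs_summable_summable[OF fourier_term_summable[OF decay[OF t], of \<omega> 0 x]] by simp
  next
    show "gkdv_classical_solution p t0 (\<lambda>t x. \<Sum>\<^sub>\<infinity>n. cd t n * exp (\<i> * of_real (dotw n \<omega> * x)))"
      unfolding u by (rule gkdv_solution[OF p0 cont decay fix_pt])
  next
    \<comment> \<open>At time zero the phase is 1 and the integral runs over a single point.\<close>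
    have "cd 0 n = c n" for n
      using fix_pt[of 0 n] t0_pos by (simp add: duhamel_def)
    then show "(\<Sum>\<^sub>\<infinity>n. cd 0 n * exp (\<i> * of_real (dotw n \<omega> * x))) = u0 x" for x
      by (simp add: u0_def)
  qed
qed

end
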